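(* Let $\mathfrak{g}$ be a seven-dimensional real Lie algebra endowed with a locally conformally cocalibrated $G_2$-structure with fundamental 3-form $\varphi$ and dual 4-form $\phi=*\varphi\in\Lambda^4\mathfrak{g}^*$, so that $d\phi=\theta\wedge\phi$ with $\theta\in\Lambda^1\mathfrak{g}^*$, $\theta\neq 0$, $d\theta=0$. Let $X=\theta^{\sharp}\in\mathfrak{g}$ be the metric dual of $\theta$, and assume that $\theta(X)=1$ and that $X$ lies in the center of $\mathfrak{g}$. Let $\mathfrak{h}=\mathfrak{g}/\mathbb{R}X$ be the six-dimensional quotient Lie algebra, and define $$\psi_-:=-\iota_X\phi,\qquad \sigma:=\phi-\psi_-\wedge\theta .$$ These are (pull-backs of) forms $\psi_-\in\Lambda^3\mathfrak{h}^*$ and $\sigma=\tfrac12\,\omega\wedge\omega$, where $\omega:=\iota_X\varphi\in\Lambda^2\mathfrak{h}^*$. Then the pair $(\omega,\psi_-)$ defines a nearly half-flat $SU(3)$-structure on $\mathfrak{h}$, i.e. $d\psi_-=k\,\omega^2$ for some $k\in\mathbb{R}\setminus\{0\}$, and its torsion is of type $W_1^{\pm}\oplus W_2^{-}\oplus W_3$.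
   Context: Forms on a Lie algebra are identified with left-invariant forms on the corresponding Lie group; $d$ is the Chevalley–Eilenberg differential, with $d\alpha(Y,Z)=-\alpha([Y,Z])$ on 1-forms. $\iota_X$ is contraction by $X$, and $\omega^2=\omega\wedge\omega$. A $G_2$-structure on a seven-dimensional Lie algebra $\mathfrak{g}$ is a 3-form $\varphi\in\Lambda^3\mathfrak{g}^*$ which in some basis $e^1,\dots,e^7$ of $\mathfrak{g}^*$ reads $\varphi=e^{127}+e^{347}+e^{567}+e^{135}-e^{146}-e^{236}-e^{245}$ (where $e^{ijk}=e^i\wedge e^j\wedge e^k$). It induces the inner product $g$ and orientation for which this basis is oriented orthonormal; $*$ is the corresponding Hodge star, and $\phi=*\varphi$. The structure is locally conformally cocalibrated if $d\phi=\theta\wedge\phi$ for a closed nonzero 1-form $\theta$ (the Lee form). The vector $\theta^\sharp$ is defined by $g(\theta^\sharp,Y)=\theta(Y)$ for all $Y\in\mathfrak{g}$. An $SU(3)$-structure on a six-dimensional Lie algebra $\mathfrak{h}$ is given by a 2-form $\omega$ and 3-forms $\psi_\pm$ for which there is a basis $e^1,\dots,e^6$ of $\mathfrak{h}^*$ with $\omega=e^{12}+e^{34}+e^{56}$ and $\psi_++i\psi_-=(e^1+ie^2)\wedge(e^3+ie^4)\wedge(e^5+ie^6)$. It is determined by the pair $(\omega,\psi_-)$. It is nearly half-flat if $d\psi_-=k\,\omega^2$ for a nonzero constant $k$ (normalized in the paper to $k=\tfrac12$). Torsion: the intrinsic torsion of an $SU(3)$-structure decomposes as $W_1^{\pm}\oplus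 W_2^{\pm}\oplus W_3\oplus W_4\oplus W_5$. Here $W_4$ corresponds to $\omega\wedge d\omega$, $W_1^\pm$ to the components of $d\psi_\pm$ along $\omega^2$, and the two $W_2$-components to the components of $d\psi_+$ and of $d\psi_-$ in $\{\beta\wedge\omega:\beta \text{ a primitive } (1,1)\text{-form}\}$. $W_3$ corresponds to the component of $d\omega$ in the primitive real forms of type $(2,1)+(1,2)$. $W_5$ corresponds to the remaining components of $d\psi_\pm$, modulo the contribution of $W_4$. "Type $W_1^{\pm}\oplus W_2^{-}\oplus W_3$" means that the $W_4$ and $W_5$ components vanish, and that of the two $W_2$-components only the one coming from $d\psi_+$ may be nonzero. *)

theory Defs
  imports Complex_Main "HOL-Library.Function_Algebras"
begin

text \<open>
  Sums, differences and \<open>0\<close> of forms are the pointwise ones of \<^theory>\<open>HOL-Library.Function_Algebras\<close>.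
  A form is a function on argument lists. A form of degree \<open>k\<close> vanishes on all lists of length
  other than \<open>k\<close>, so that the degree need not be passed to the operations below and equality
  of forms is equality of functions.
\<close>

type_synonym 'a form = "'a list \<Rightarrow> real"

definition is_form :: "nat \<Rightarrow> ('a::real_vector) form \<Rightarrow> bool" where
  "is_form k \<alpha> \<longleftrightarrow>
     (\<forall>vs. length vs \<noteq> k \<longrightarrow> \<alpha> vs = 0) \<and>
     (\<forall>vs i. length vs = k \<and> i < k \<longrightarrow> linear (\<lambda>v. \<alpha> (vs[i := v]))) \<and>
     (\<forall>vs. \<not> distinct vs \<longrightarrow> \<alpha> vs = 0)"

definition scale_form :: "'c::comm_ring_1 \<Rightarrow> ('a list \<Rightarrow> 'c) \<Rightarrow> 'a list \<Rightarrow> 'c"  (infixr "*\<^sub>F" 75) where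
  "c *\<^sub>F \<alpha> = (\<lambda>vs. c * \<alpha> vs)"

text \<open>
  The wedge product as a sum over shuffles: \<open>I\<close> is the set of positions whose arguments go to \<open>\<alpha>\<close>,
  and the exponent counts the inversions of the shuffle. Hence \<open>\<alpha> \<and>\<^sub>F \<beta>\<close> takes \<open>[u, v]\<close> to
  \<open>\<alpha> [u] * \<beta> [v] - \<alpha> [v] * \<beta> [u]\<close> for 1-forms. The coefficients are polymorphic, to allow
  complex-valued forms.
\<close>

definition wedge :: "('a list \<Rightarrow> 'c::comm_ring_1) \<Rightarrow> ('a list \<Rightarrow> 'c) \<Rightarrow> 'a list \<Rightarrow> 'c"  (infixr "\<and>\<^sub>F" 70) where
  "\<alpha> \<and>\<^sub>F \<beta> = (\<lambda>vs. \<Sum>I \<in> Pow {..<length vs}.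
      (-1) ^ card {(i, j). i \<in> I \<and> j \<notin> I \<and> j < i} * \<alpha> (nths vs I) * \<beta> (nths vs (- I)))"

definition unit_form :: "'a list \<Rightarrow> 'c::comm_ring_1" where
  "unit_form = (\<lambda>vs. if vs = [] then 1 else 0)"

definition complex_form :: "'a form \<Rightarrow> 'a form \<Rightarrow> 'a list \<Rightarrow> complex" where
  "complex_form \<alpha> \<beta> = (\<lambda>vs. Complex (\<alpha> vs) (\<beta> vs))"

definition contract :: "'a \<Rightarrow> 'a form \<Rightarrow> 'a form" where
  "contract X \<alpha> = (\<lambda>vs. \<alpha> (X # vs))"

definition pullback :: "('a \<Rightarrow> 'b) \<Rightarrow> 'b form \<Rightarrow> 'a form" where
  "pullback q \<alpha> = (\<lambda>vs. \<alpha> (map q vs))"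


definition lie_algebra :: "('a::real_vector \<Rightarrow> 'a \<Rightarrow> 'a) \<Rightarrow> bool" where
  "lie_algebra br \<longleftrightarrow>
     (\<forall>x. linear (br x)) \<and> (\<forall>y. linear (\<lambda>x. br x y)) \<and>
     (\<forall>x. br x x = 0) \<and>
     (\<forall>x y z. br x (br y z) + br y (br z x) + br z (br x y) = 0)"

definition in_center :: "('a::real_vector \<Rightarrow> 'a \<Rightarrow> 'a) \<Rightarrow> 'a \<Rightarrow> bool" where
  "in_center br X \<longleftrightarrow> (\<forall>Y. br X Y = 0)"

text \<open>
  The quotient of a Lie algebra by the line through \<open>X\<close> depends on \<open>X\<close>, so it is not a type. It is
  given, up to unique isomorphism, by its projection \<open>q\<close>.
\<close>

definition lie_quotient_by_line ::
  "('a::real_vector \<Rightarrow> 'a \<Rightarrow> 'a) \<Rightarrow> 'a \<Rightarrow> ('b::real_vector \<Rightarrow> 'b \<Rightarrow> 'b) \<Rightarrow> ('a \<Rightarrow> 'b) \<Rightarrow> bool" where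
  "lie_quotient_by_line br X br' q \<longleftrightarrow>
     lie_algebra br' \<and> linear q \<and> surj q \<and> {v. q v = 0} = span {X} \<and>
     (\<forall>u v. q (br u v) = br' (q u) (q v))"

definition ce_d :: "('a \<Rightarrow> 'a \<Rightarrow> 'a) \<Rightarrow> 'a form \<Rightarrow> 'a form" where
  "ce_d br \<alpha> = (\<lambda>vs. \<Sum>j<length vs. \<Sum>i<j.
      (-1) ^ (i + j) * \<alpha> (br (vs ! i) (vs ! j) # nths vs (- {i, j})))"


definition is_coframe :: "nat \<Rightarrow> (nat \<Rightarrow> ('a::real_vector) form) \<Rightarrow> bool" where
  "is_coframe n e \<longleftrightarrow>
     (\<forall>i\<in>{1..n}. is_form 1 (e i)) \<and>
     (\<forall>c. (\<Sum>i\<in>{1..n}. c i *\<^sub>F e i) = 0 \<longrightarrow> (\<forall>i\<in>{1..n}. c i = 0)) \<and>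
     (\<forall>\<alpha>. is_form 1 \<alpha> \<longrightarrow> (\<exists>c. \<alpha> = (\<Sum>i\<in>{1..n}. c i *\<^sub>F e i)))"

definition dual_frame :: "nat \<Rightarrow> (nat \<Rightarrow> 'a form) \<Rightarrow> nat \<Rightarrow> 'a" where
  "dual_frame n e i = (THE v. \<forall>j\<in>{1..n}. e j [v] = (if j = i then 1 else 0))"

text \<open>The metric, volume form and Hodge star for which \<open>e 1, \<dots>, e n\<close> is oriented orthonormal.\<close>

definition coframe_metric :: "nat \<Rightarrow> (nat \<Rightarrow> 'a form) \<Rightarrow> 'a \<Rightarrow> 'a \<Rightarrow> real" where
  "coframe_metric n e u v = (\<Sum>i\<in>{1..n}. e i [u] * e i [v])"

definition volume_form :: "nat \<Rightarrow> (nat \<Rightarrow> 'a form) \<Rightarrow> 'a form" where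
  "volume_form n e = foldr wedge (map e [1..<Suc n]) unit_form"

definition form_inner :: "nat \<Rightarrow> (nat \<Rightarrow> 'a form) \<Rightarrow> 'a form \<Rightarrow> 'a form \<Rightarrow> real" where
  "form_inner n e \<alpha> \<beta> = (\<Sum>I \<in> Pow {1..n}.
      \<alpha> (map (dual_frame n e) (sorted_list_of_set I)) *
      \<beta> (map (dual_frame n e) (sorted_list_of_set I)))"

definition is_hodge_star ::
  "nat \<Rightarrow> (nat \<Rightarrow> ('a::real_vector) form) \<Rightarrow> nat \<Rightarrow> 'a form \<Rightarrow> 'a form \<Rightarrow> bool" where
  "is_hodge_star n e k \<beta> \<gamma> \<longleftrightarrow>
     is_form (n - k) \<gamma> \<and>
     (\<forall>\<alpha>. is_form k \<alpha> \<longrightarrow> \<alpha> \<and>\<^sub>F \<gamma> = form_inner n e \<alpha> \<beta> *\<^sub>F volume_form n e)"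


definition g2_adapted :: "(nat \<Rightarrow> ('a::real_vector) form) \<Rightarrow> 'a form \<Rightarrow> bool" where
  "g2_adapted e \<phi> \<longleftrightarrow> is_coframe 7 e \<and>
     \<phi> = (e 1 \<and>\<^sub>F e 2 \<and>\<^sub>F e 7) + (e 3 \<and>\<^sub>F e 4 \<and>\<^sub>F e 7) + (e 5 \<and>\<^sub>F e 6 \<and>\<^sub>F e 7)
       + (e 1 \<and>\<^sub>F e 3 \<and>\<^sub>F e 5) - (e 1 \<and>\<^sub>F e 4 \<and>\<^sub>F e 6)
       - (e 2 \<and>\<^sub>F e 3 \<and>\<^sub>F e 6) - (e 2 \<and>\<^sub>F e 4 \<and>\<^sub>F e 5)"

text \<open>Here \<open>\<Phi>\<close> is the dual 4-form and \<open>\<theta>\<close> the Lee form.\<close>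

definition locally_conformally_cocalibrated ::
  "('a::real_vector \<Rightarrow> 'a \<Rightarrow> 'a) \<Rightarrow> 'a form \<Rightarrow> 'a form \<Rightarrow> bool" where
  "locally_conformally_cocalibrated br \<Phi> \<theta> \<longleftrightarrow>
     is_form 1 \<theta> \<and> \<theta> \<noteq> 0 \<and> ce_d br \<theta> = 0 \<and> ce_d br \<Phi> = \<theta> \<and>\<^sub>F \<Phi>"


definition su3_structure :: "('a::real_vector) form \<Rightarrow> 'a form \<Rightarrow> 'a form \<Rightarrow> bool" where
  "su3_structure \<omega> \<psi>p \<psi>m \<longleftrightarrow> (\<exists>e. is_coframe 6 e \<and>
     \<omega> = (e 1 \<and>\<^sub>F e 2) + (e 3 \<and>\<^sub>F e 4) + (e 5 \<and>\<^sub>F e 6) \<and>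
     complex_form \<psi>p \<psi>m =
       complex_form (e 1) (e 2) \<and>\<^sub>F complex_form (e 3) (e 4) \<and>\<^sub>F complex_form (e 5) (e 6))"

definition nearly_half_flat :: "('a \<Rightarrow> 'a \<Rightarrow> 'a) \<Rightarrow> 'a form \<Rightarrow> 'a form \<Rightarrow> bool" where
  "nearly_half_flat br \<omega> \<psi>m \<longleftrightarrow> (\<exists>k. k \<noteq> 0 \<and> ce_d br \<psi>m = k *\<^sub>F (\<omega> \<and>\<^sub>F \<omega>))"

text \<open>
  For an \<open>SU(3)\<close>-structure, \<open>J\<close> is uniquely determined by the requirement that the complex volume
  form \<open>\<psi>p + \<i> \<psi>m\<close> be of type (3,0).
\<close>

definition is_acs :: "('a::real_vector) form \<Rightarrow> 'a form \<Rightarrow> ('a \<Rightarrow> 'a) \<Rightarrow> bool" where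
  "is_acs \<psi>p \<psi>m J \<longleftrightarrow> linear J \<and> (\<forall>v. J (J v) = - v) \<and>
     (\<forall>u v w. complex_form \<psi>p \<psi>m [J u, v, w] = \<i> * complex_form \<psi>p \<psi>m [u, v, w])"

definition primitive_11 :: "('a::real_vector) form \<Rightarrow> 'a form \<Rightarrow> 'a form \<Rightarrow> 'a form \<Rightarrow> bool" where
  "primitive_11 \<omega> \<psi>p \<psi>m \<beta> \<longleftrightarrow> is_form 2 \<beta> \<and>
     (\<exists>J. is_acs \<psi>p \<psi>m J \<and> (\<forall>u v. \<beta> [J u, J v] = \<beta> [u, v])) \<and>
     \<beta> \<and>\<^sub>F \<omega> \<and>\<^sub>F \<omega> = 0"

text \<open>
  The decomposition of a 4-form \<open>\<gamma>\<close> into irreducible \<open>SU(3)\<close>-components, of dimensions 1, 8 and 6.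
  It exists and is unique, so a component vanishes iff there is a decomposition in which it is 0.
  The last component is what remains besides the multiples of \<open>\<omega>\<^sup>2\<close> and the \<open>\<beta> \<and>\<^sub>F \<omega>\<close>.
\<close>

definition four_form_components ::
  "('a::real_vector) form \<Rightarrow> 'a form \<Rightarrow> 'a form \<Rightarrow> 'a form \<Rightarrow> real \<Rightarrow> 'a form \<Rightarrow> 'a form \<Rightarrow> bool" where
  "four_form_components \<omega> \<psi>p \<psi>m \<gamma> c \<beta> \<alpha> \<longleftrightarrow>
     primitive_11 \<omega> \<psi>p \<psi>m \<beta> \<and> is_form 1 \<alpha> \<and>
     \<gamma> = c *\<^sub>F (\<omega> \<and>\<^sub>F \<omega>) + (\<beta> \<and>\<^sub>F \<omega>) + (\<alpha> \<and>\<^sub>F \<psi>p)"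

definition W2_component_vanishes ::
  "('a::real_vector) form \<Rightarrow> 'a form \<Rightarrow> 'a form \<Rightarrow> 'a form \<Rightarrow> bool" where
  "W2_component_vanishes \<omega> \<psi>p \<psi>m \<gamma> \<longleftrightarrow> (\<exists>c \<alpha>. four_form_components \<omega> \<psi>p \<psi>m \<gamma> c 0 \<alpha>)"

definition W5_component_vanishes ::
  "('a::real_vector) form \<Rightarrow> 'a form \<Rightarrow> 'a form \<Rightarrow> 'a form \<Rightarrow> bool" where
  "W5_component_vanishes \<omega> \<psi>p \<psi>m \<gamma> \<longleftrightarrow> (\<exists>c \<beta>. four_form_components \<omega> \<psi>p \<psi>m \<gamma> c \<beta> 0)"

text \<open>
  Torsion of type \<open>W\<^sub>1\<^sup>\<plusminus> \<oplus> W\<^sub>2\<^sup>- \<oplus> W\<^sub>3\<close>: \<open>W\<^sub>4\<close> and \<open>W\<^sub>5\<close> vanish, and so does the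
  \<open>W\<^sub>2\<close>-component of \<open>d \<psi>m\<close>; the one of \<open>d \<psi>p\<close> and all of \<open>W\<^sub>1\<^sup>\<plusminus>\<close> and \<open>W\<^sub>3\<close> are unrestricted.
  Since \<open>W\<^sub>4\<close> vanishes, it makes no contribution to be discounted from \<open>W\<^sub>5\<close>.
\<close>

definition torsion_type_W1_W2minus_W3 ::
  "('a::real_vector \<Rightarrow> 'a \<Rightarrow> 'a) \<Rightarrow> 'a form \<Rightarrow> 'a form \<Rightarrow> 'a form \<Rightarrow> bool" where
  "torsion_type_W1_W2minus_W3 br \<omega> \<psi>p \<psi>m \<longleftrightarrow>
     \<omega> \<and>\<^sub>F ce_d br \<omega> = 0 \<and>
     W5_component_vanishes \<omega> \<psi>p \<psi>m (ce_d br \<psi>p) \<and>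
     W5_component_vanishes \<omega> \<psi>p \<psi>m (ce_d br \<psi>m) \<and>
     W2_component_vanishes \<omega> \<psi>p \<psi>m (ce_d br \<psi>m)"

end

theory Submission
  imports Defs
begin

text \<open>
  The group \<open>G\<^sub>2\<close> acts transitively on unit vectors. Hence the adapted coframe can be chosen such that
  \<open>X\<close> is the last vector of the dual frame, and then \<open>\<theta> = e\<^sup>7\<close>, \<open>\<phi> = \<omega> \<and> \<theta> + \<psi>\<^sub>+\<close> and
  \<open>\<Phi> = \<omega>\<^sup>2/2 + \<psi>\<^sub>- \<and> \<theta>\<close> with the standard \<open>SU(3)\<close>-forms \<open>\<omega>\<close>, \<open>\<psi>\<^sub>+\<close>, \<open>\<psi>\<^sub>-\<close> in \<open>e\<^sup>1, \<dots>, e\<^sup>6\<close>. These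
  six covectors annihilate \<open>X\<close> and so descend to the quotient (\<open>g2_transitive_on_unit_vectors\<close>,
  \<open>frame_descends\<close>, \<open>g2_contractions\<close>).

  As \<open>X\<close> is central, the Lie derivative along \<open>X\<close> vanishes, and Cartan's formula gives
  \<open>d \<psi>\<^sub>- = - d (\<iota>\<^sub>X \<Phi>) = \<iota>\<^sub>X (d \<Phi>) = \<iota>\<^sub>X (\<theta> \<and> \<Phi>) = \<Phi> - \<psi>\<^sub>- \<and> \<theta> = \<omega>\<^sup>2/2\<close>. So \<open>d \<psi>\<^sub>-\<close> has neither a \<open>W\<^sub>2\<close>-
  nor a \<open>W\<^sub>5\<close>-component. Applying \<open>d\<close> to \<open>\<Phi> = \<omega>\<^sup>2/2 + \<psi>\<^sub>- \<and> \<theta>\<close> and comparing with \<open>\<theta> \<and> \<Phi>\<close> leaves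
  \<open>d (\<omega>\<^sup>2) = 0\<close>, that is \<open>\<omega> \<and> d \<omega> = 0\<close>, so \<open>W\<^sub>4\<close> vanishes.

  There remains the \<open>W\<^sub>5\<close>-component of \<open>d \<psi>\<^sub>+\<close>. The form \<open>\<Omega> = \<psi>\<^sub>+ + \<i> \<psi>\<^sub>-\<close> has type (3,0), and so
  \<open>d \<Omega>\<close> has no (1,3)-part: each term of \<open>d \<Omega>\<close> on three vectors of type (0,1) and a fourth one feeds at
  least one of the three to \<open>\<Omega>\<close>. Since \<open>d \<psi>\<^sub>-\<close> is a multiple of \<open>\<omega>\<^sup>2\<close>, which is of type (2,2), the form
  \<open>d \<psi>\<^sub>+ = d \<Omega> - \<i> d \<psi>\<^sub>-\<close> has no (1,3)-part either; as it is real, it is of type (2,2). In complex dimension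
  three the real (2,2)-forms are the \<open>c \<omega>\<^sup>2 + \<beta> \<and> \<omega>\<close> with \<open>\<beta>\<close> a primitive (1,1)-form
  (\<open>ce_d_volume_type\<close>, \<open>torsion_of_nearly_half_flat\<close>).

  A form is a function on argument lists, and identities between forms are proved by induction on
  the list: contraction with its head is an antiderivation of the wedge product (\<open>wedge_Cons\<close>), and
  Cartan's formula is a recursion for the differential (\<open>ce_d_eq_cartan_d\<close>), from which the Leibniz
  rule \<open>cartan_d_wedge\<close> follows. Equations between particular forms, such as the formula for the dual 4-form
  (\<open>hodge_star_g2_form\<close>), are checked on increasing tuples of frame vectors
  (\<open>form_eq_on_frameI\<close>).
\<close>

section \<open>The exterior product and contraction\<close>

text \<open>
  The grading involution, which carries the sign in the antiderivation rules without any
  reference to a degree.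
\<close>

definition grade :: "'a form \<Rightarrow> 'a form" where
  "grade \<alpha> = (\<lambda>vs. (-1) ^ length vs * \<alpha> vs)"

lemma wedge_Nil: "(\<alpha> \<and>\<^sub>F \<beta>) [] = \<alpha> [] * \<beta> []"
  by (simp add: wedge_def)

text \<open>
  The antiderivation rule of contraction. The shuffles split into those which give the first
  argument to \<open>\<alpha>\<close> and those which give it to \<open>\<beta>\<close>; in the latter every argument of \<open>\<alpha>\<close> makes one
  inversion with it. Together with \<open>wedge_Nil\<close> this determines the wedge product by recursion.
\<close>

lemma wedge_Cons:
  fixes \<alpha> \<beta> :: "'a form"
  shows "(\<alpha> \<and>\<^sub>F \<beta>) (v # vs) =
    (contract v \<alpha> \<and>\<^sub>F \<beta>) vs + (grade \<alpha> \<and>\<^sub>F contract v \<beta>) vs"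
proof -
  let ?n = "length vs"
  let ?inv = "\<lambda>I::nat set. {(i, j). i \<in> I \<and> j \<notin> I \<and> j < i}"
  let ?t = "\<lambda>I. (-1) ^ card (?inv I) * \<alpha> (nths (v # vs) I) * \<beta> (nths (v # vs) (- I))"
  let ?P = "Pow {..<?n}"
  have split: "Pow {..<length (v # vs)} =
      (\<lambda>I. insert 0 (Suc ` I)) ` ?P \<union> (\<lambda>I. Suc ` I) ` ?P" (is "?L = ?A \<union> ?B")
    by (simp add: lessThan_Suc_eq_insert_0 Pow_insert image_Pow_surj[OF refl, symmetric])
      (simp add: image_comp comp_def Un_commute)
  have inj: "inj_on (\<lambda>I. insert 0 (Suc ` I)) ?P" "inj_on (\<lambda>I. Suc ` I) ?P"
    by (auto simp: inj_on_def)
  have dj: "?A \<inter> ?B = {}" by auto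
  have "(\<alpha> \<and>\<^sub>F \<beta>) (v # vs) = sum ?t (?A \<union> ?B)"
    unfolding wedge_def split ..
  also have "\<dots> = sum ?t ?A + sum ?t ?B"
    by (rule sum.union_disjoint) (use dj in auto)
  also have "sum ?t ?A = (contract v \<alpha> \<and>\<^sub>F \<beta>) vs"
    unfolding sum.reindex[OF inj(1)] wedge_def comp_def
  proof (rule sum.cong[OF refl])
    fix I assume "I \<in> ?P"
    \<comment> \<open>position 0 belongs to the first factor and takes part in no inversion\<close>
    have "?inv (insert 0 (Suc ` I)) = map_prod Suc Suc ` ?inv I"
      by (force simp: image_iff gr0_conv_Suc less_Suc_eq_0_disj)
    then have "card (?inv (insert 0 (Suc ` I))) = card (?inv I)"
      by (simp add: card_image inj_on_def)
    then show "?t (insert 0 (Suc ` I)) = (-1) ^ card (?inv I) * contract v \<alpha> (nths vs I) * \<beta> (nths vs (- I))"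
      by (simp add: nths_Cons inj_image_mem_iff[OF inj_Suc] Compl_eq contract_def)
  qed
  also have "sum ?t ?B = (grade \<alpha> \<and>\<^sub>F contract v \<beta>) vs"
    unfolding sum.reindex[OF inj(2)] wedge_def comp_def
  proof (rule sum.cong[OF refl])
    fix I assume I: "I \<in> ?P"
    have fin: "finite I" using I finite_subset by auto
    \<comment> \<open>position 0 belongs to the second factor and is inverted with all of \<open>I\<close>\<close>
    have "?inv (Suc ` I) = map_prod Suc Suc ` ?inv I \<union> (\<lambda>i. (Suc i, 0)) ` I"
      by (force simp: image_iff gr0_conv_Suc less_Suc_eq_0_disj)
    moreover have "finite (?inv I)"
      by (rule finite_subset[of _ "I \<times> {..<?n}"]) (use I fin in auto)
    moreover have "card (map_prod Suc Suc ` ?inv I) = card (?inv I)" "card ((\<lambda>i. (Suc i, 0::nat)) ` I) = card I"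
      by (simp_all add: card_image inj_on_def)
    moreover have "map_prod Suc Suc ` ?inv I \<inter> (\<lambda>i. (Suc i, 0)) ` I = {}"
      by auto
    ultimately have "card (?inv (Suc ` I)) = card (?inv I) + card I"
      using fin by (simp only: card_Un_disjoint finite_imageI)
    moreover have "card I = length (nths vs I)"
      using I by (auto simp: length_nths intro: arg_cong[where f = card])
    ultimately show "?t (Suc ` I) = (-1) ^ card (?inv I) * grade \<alpha> (nths vs I) * contract v \<beta> (nths vs (- I))"
      by (simp add: nths_Cons inj_image_mem_iff[OF inj_Suc] grade_def power_add Compl_eq contract_def)
  qed
  finally show ?thesis .
qed

lemma contract_wedge:
  "contract v (\<alpha> \<and>\<^sub>F \<beta>) = (contract v \<alpha> \<and>\<^sub>F \<beta>) + (grade \<alpha> \<and>\<^sub>F contract v \<beta>)"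
  by (simp add: fun_eq_iff wedge_Cons contract_def[of _ "_ \<and>\<^sub>F _"])

lemma scale_form_apply: "(c *\<^sub>F \<alpha>) vs = c * \<alpha> vs"
  by (simp add: scale_form_def)

lemma wedge_add_left: "(\<alpha> + \<beta>) \<and>\<^sub>F \<gamma> = (\<alpha> \<and>\<^sub>F \<gamma>) + (\<beta> \<and>\<^sub>F \<gamma>)"
  by (simp add: wedge_def fun_eq_iff algebra_simps sum.distrib)

lemma wedge_add_right: "\<gamma> \<and>\<^sub>F (\<alpha> + \<beta>) = (\<gamma> \<and>\<^sub>F \<alpha>) + (\<gamma> \<and>\<^sub>F \<beta>)"
  by (simp add: wedge_def fun_eq_iff algebra_simps sum.distrib)

lemma wedge_scale_left: "(c *\<^sub>F \<alpha>) \<and>\<^sub>F \<gamma> = c *\<^sub>F (\<alpha> \<and>\<^sub>F \<gamma>)"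
  by (simp add: wedge_def scale_form_def fun_eq_iff sum_distrib_left algebra_simps)

lemma wedge_scale_right: "\<gamma> \<and>\<^sub>F (c *\<^sub>F \<alpha>) = c *\<^sub>F (\<gamma> \<and>\<^sub>F \<alpha>)"
  by (simp add: wedge_def scale_form_def fun_eq_iff sum_distrib_left algebra_simps)

lemma wedge_minus_left: "(- \<alpha>) \<and>\<^sub>F \<gamma> = - (\<alpha> \<and>\<^sub>F \<gamma>)"
  by (simp add: wedge_def fun_eq_iff sum_negf)

lemma wedge_minus_right: "\<gamma> \<and>\<^sub>F (- \<alpha>) = - (\<gamma> \<and>\<^sub>F \<alpha>)"
  by (simp add: wedge_def fun_eq_iff sum_negf)

lemma wedge_diff_left: "(\<alpha> - \<beta>) \<and>\<^sub>F \<gamma> = (\<alpha> \<and>\<^sub>F \<gamma>) - (\<beta> \<and>\<^sub>F \<gamma>)"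
  by (simp add: wedge_def fun_eq_iff algebra_simps sum_subtractf)

lemma wedge_diff_right: "\<gamma> \<and>\<^sub>F (\<alpha> - \<beta>) = (\<gamma> \<and>\<^sub>F \<alpha>) - (\<gamma> \<and>\<^sub>F \<beta>)"
  by (simp add: wedge_def fun_eq_iff algebra_simps sum_subtractf)

lemma wedge_zero_left: "0 \<and>\<^sub>F \<gamma> = 0"
  by (simp add: wedge_def fun_eq_iff)

lemma wedge_zero_right: "\<gamma> \<and>\<^sub>F 0 = 0"
  by (simp add: wedge_def fun_eq_iff)

lemma grade_grade: "grade (grade \<alpha>) = \<alpha>"
  by (simp add: grade_def fun_eq_iff flip: mult.assoc power_mult_distrib)

lemma contract_grade: "contract v (grade \<alpha>) = - grade (contract v \<alpha>)"
  by (simp add: grade_def fun_eq_iff contract_def)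

lemma grade_wedge: "grade (\<alpha> \<and>\<^sub>F \<beta>) = grade \<alpha> \<and>\<^sub>F grade \<beta>"
proof
  fix vs
  show "grade (\<alpha> \<and>\<^sub>F \<beta>) vs = (grade \<alpha> \<and>\<^sub>F grade \<beta>) vs"
  proof (induction vs arbitrary: \<alpha> \<beta>)
    case Nil
    then show ?case by (simp add: grade_def wedge_Nil)
  next
    case (Cons v vs)
    show ?case
      by (subst wedge_Cons)
        (simp add: contract_grade wedge_minus_left wedge_minus_right flip: Cons.IH,
         simp add: grade_def wedge_Cons algebra_simps)
  qed
qed

text \<open>
  Both sides satisfy the same recursion, because contraction acts on either as an antiderivation
  in three factors.
\<close>

lemma wedge_assoc: "(\<alpha> \<and>\<^sub>F \<beta>) \<and>\<^sub>F \<gamma> = \<alpha> \<and>\<^sub>F (\<beta> \<and>\<^sub>F \<gamma>)"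
  for \<alpha> \<beta> \<gamma> :: "'a form"
proof
  fix vs
  show "((\<alpha> \<and>\<^sub>F \<beta>) \<and>\<^sub>F \<gamma>) vs = (\<alpha> \<and>\<^sub>F (\<beta> \<and>\<^sub>F \<gamma>)) vs"
  proof (induction vs arbitrary: \<alpha> \<beta> \<gamma>)
    case Nil
    then show ?case by (simp add: wedge_Nil algebra_simps)
  next
    case (Cons v vs)
    show ?case
      by (simp add: wedge_Cons[of "\<alpha> \<and>\<^sub>F \<beta>"] wedge_Cons[of \<alpha>] contract_wedge wedge_add_left wedge_add_right
          grade_wedge Cons.IH)
  qed
qed

definition has_degree :: "nat \<Rightarrow> 'a form \<Rightarrow> bool" where
  "has_degree k \<alpha> \<longleftrightarrow> (\<forall>vs. length vs \<noteq> k \<longrightarrow> \<alpha> vs = 0)"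

lemma grade_degree: "has_degree k \<alpha> \<Longrightarrow> grade \<alpha> = (-1) ^ k *\<^sub>F \<alpha>"
  by (force simp: has_degree_def grade_def scale_form_def)

lemma has_degree_contract: "has_degree k \<alpha> \<Longrightarrow> has_degree (k - 1) (contract v \<alpha>)"
  by (auto simp: has_degree_def contract_def)

lemma has_degree_0_contract: "has_degree 0 \<alpha> \<Longrightarrow> contract v \<alpha> = 0"
  by (auto simp: has_degree_def contract_def)

lemma wedge_commute:
  assumes "has_degree k \<alpha>" "has_degree l \<beta>"
  shows "\<alpha> \<and>\<^sub>F \<beta> = (-1) ^ (k * l) *\<^sub>F (\<beta> \<and>\<^sub>F \<alpha>)"
proof
  fix vs
  show "(\<alpha> \<and>\<^sub>F \<beta>) vs = ((-1) ^ (k * l) *\<^sub>F (\<beta> \<and>\<^sub>F \<alpha>)) vs"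
    using assms
  proof (induction vs arbitrary: k l \<alpha> \<beta>)
    case Nil
    then show ?case
      by (cases "k = 0 \<or> l = 0") (auto simp: wedge_Nil scale_form_def has_degree_def)
  next
    case (Cons v vs)
    let ?a = "contract v \<alpha>" and ?b = "contract v \<beta>"
    have 1: "(?a \<and>\<^sub>F \<beta>) vs = (-1) ^ (k * l) * (-1) ^ l * (\<beta> \<and>\<^sub>F ?a) vs"
    proof (cases k)
      case 0
      then show ?thesis
        using Cons.prems by (simp add: has_degree_0_contract wedge_zero_left wedge_zero_right)
    next
      case (Suc m)
      have "(?a \<and>\<^sub>F \<beta>) vs = ((-1) ^ (m * l) *\<^sub>F (\<beta> \<and>\<^sub>F ?a)) vs"
        using Cons.prems Suc has_degree_contract[of k \<alpha>] by (intro Cons.IH) auto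
      then show ?thesis
        by (simp add: Suc scale_form_def power_add flip: power_mult_distrib)
    qed
    have 2: "(-1) ^ k * (\<alpha> \<and>\<^sub>F ?b) vs = (-1) ^ (k * l) * (?b \<and>\<^sub>F \<alpha>) vs"
    proof (cases l)
      case 0
      then show ?thesis
        using Cons.prems by (simp add: has_degree_0_contract wedge_zero_left wedge_zero_right)
    next
      case (Suc m)
      have "(\<alpha> \<and>\<^sub>F ?b) vs = ((-1) ^ (k * m) *\<^sub>F (?b \<and>\<^sub>F \<alpha>)) vs"
        using Cons.prems Suc has_degree_contract[of l \<beta>] by (intro Cons.IH) auto
      then show ?thesis
        by (simp add: Suc scale_form_def power_add)
    qed
    show ?case
      using 1 2 Cons.prems
      by (simp add: wedge_Cons grade_degree wedge_scale_left scale_form_apply algebra_simps)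
  qed
qed


section \<open>Multilinear and alternating forms\<close>

text \<open>
  Here and in \<open>alternating\<close> the slot is given by splitting the argument list, so that both properties
  pass to contractions and can be proved by induction on the part before the slot. Antisymmetry is
  asked for adjacent slots only; the rest follows by moving arguments.
\<close>

definition multilinear :: "('a::real_vector) form \<Rightarrow> bool" where
  "multilinear \<alpha> \<longleftrightarrow> (\<forall>us ws. linear (\<lambda>v. \<alpha> (us @ v # ws)))"

definition alternating :: "'a form \<Rightarrow> bool" where
  "alternating \<alpha> \<longleftrightarrow> (\<forall>us v w ws. \<alpha> (us @ v # w # ws) = - \<alpha> (us @ w # v # ws))"

lemma alternatingD: "alternating \<alpha> \<Longrightarrow> \<alpha> (us @ v # w # ws) = - \<alpha> (us @ w # v # ws)"
  unfolding alternating_def by blast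

lemma alternatingI:
  "(\<And>us v w ws. \<alpha> (us @ v # w # ws) = - \<alpha> (us @ w # v # ws)) \<Longrightarrow> alternating \<alpha>"
  unfolding alternating_def by blast

text \<open>
  Used with \<open>bs\<close> the segment between two equal arguments, this makes them adjacent.
\<close>

lemma alternating_move:
  assumes "alternating \<alpha>"
  shows "\<alpha> (us @ v # bs @ ws) = (-1) ^ length bs * \<alpha> (us @ bs @ v # ws)"
proof (induction bs arbitrary: us)
  case Nil
  then show ?case by simp
next
  case (Cons b bs)
  have "\<alpha> (us @ v # (b # bs) @ ws) = - \<alpha> ((us @ [b]) @ v # bs @ ws)"
    using alternatingD[OF assms, of us v b "bs @ ws"] by simp
  then show ?case
    unfolding Cons.IH by simp
qed

text \<open>
  The three properties on the right are stable under contraction without any bookkeeping of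
  indices, unlike the defining conditions of a \<open>k\<close>-form.
\<close>

lemma is_form_iff:
  "is_form k \<alpha> \<longleftrightarrow> has_degree k \<alpha> \<and> multilinear \<alpha> \<and> alternating \<alpha>"
proof (intro iffI conjI)
  assume *: "is_form k \<alpha>"
  show "has_degree k \<alpha>"
    using * by (simp add: is_form_def has_degree_def)
  have lin: "linear (\<lambda>v. \<alpha> (us @ v # ws))" for us ws
  proof (cases "length us + 1 + length ws = k")
    case True
    then have "linear (\<lambda>v. \<alpha> ((us @ 0 # ws)[length us := v]))"
      using *[unfolded is_form_def, THEN conjunct2, THEN conjunct1, rule_format,
          of "us @ 0 # ws" "length us"] by simp
    then show ?thesis by simp
  next
    case False
    then have "\<alpha> (us @ v # ws) = 0" for v
      using * by (auto simp: is_form_def)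
    then show ?thesis by (simp add: linear_iff)
  qed
  then show "multilinear \<alpha>"
    by (simp add: multilinear_def)
  \<comment> \<open>polarization: expand the zero value on \<open>v + w, v + w\<close>\<close>
  have same: "\<alpha> (us @ x # x # ws) = 0" for us x ws
    using * by (simp add: is_form_def)
  show "alternating \<alpha>"
  proof (rule alternatingI)
    fix us v w ws
    have l1: "\<alpha> (us @ (x + y) # z # ws) = \<alpha> (us @ x # z # ws) + \<alpha> (us @ y # z # ws)" for x y z
      using lin[of us "z # ws"] by (simp add: linear_iff)
    have l2: "\<alpha> (us @ z # (x + y) # ws) = \<alpha> (us @ z # x # ws) + \<alpha> (us @ z # y # ws)" for x y z
      using lin[of "us @ [z]" ws] by (simp add: linear_iff)
    show "\<alpha> (us @ v # w # ws) = - \<alpha> (us @ w # v # ws)"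
      using same[of us "v + w" ws] unfolding l1 l2 by (simp add: same)
  qed
next
  assume *: "has_degree k \<alpha> \<and> multilinear \<alpha> \<and> alternating \<alpha>"
  have "linear (\<lambda>v. \<alpha> (vs[i := v]))" if "i < length vs" for vs i
    using * that by (simp add: multilinear_def upd_conv_take_nth_drop)
  moreover have "\<alpha> vs = 0" if nd: "\<not> distinct vs" for vs
  proof -
    obtain us v bs ws where vs: "vs = us @ [v] @ bs @ [v] @ ws"
      using not_distinct_decomp[OF nd] by blast
    have "\<alpha> vs = (-1) ^ length bs * \<alpha> ((us @ bs) @ v # v # ws)"
      using alternating_move[of \<alpha> us v bs "v # ws"] * by (simp add: vs)
    also have "\<alpha> ((us @ bs) @ v # v # ws) = 0"
    proof -
      have "\<alpha> ((us @ bs) @ v # v # ws) = - \<alpha> ((us @ bs) @ v # v # ws)"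
        using * unfolding alternating_def by blast
      then show ?thesis by simp
    qed
    finally show ?thesis by simp
  qed
  ultimately show "is_form k \<alpha>"
    using * by (simp add: is_form_def has_degree_def)
qed

lemma contract_add: "contract v (\<alpha> + \<beta>) = contract v \<alpha> + contract v \<beta>"
  and contract_diff: "contract v (\<alpha> - \<beta>) = contract v \<alpha> - contract v \<beta>"
  and contract_scale: "contract v (c *\<^sub>F \<alpha>) = c *\<^sub>F contract v \<alpha>"
  by (simp_all add: contract_def scale_form_def fun_eq_iff)

lemma form_Cons: "\<alpha> (v # vs) = contract v \<alpha> vs"
  by (simp add: contract_def)

lemma multilinear_contract:
  assumes "multilinear \<alpha>"
  shows "multilinear (contract v \<alpha>)"
proof -
  have "linear (\<lambda>x. \<alpha> ((v # us) @ x # ws))" for us ws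
    using assms unfolding multilinear_def by blast
  then show ?thesis by (simp add: multilinear_def contract_def)
qed

lemma multilinear_grade: "multilinear \<alpha> \<Longrightarrow> multilinear (grade \<alpha>)"
  unfolding multilinear_def grade_def by (simp add: linear_iff algebra_simps)

lemma multilinear_add: "multilinear \<alpha> \<Longrightarrow> multilinear \<beta> \<Longrightarrow> multilinear (\<alpha> + \<beta>)"
  and multilinear_minus: "multilinear \<alpha> \<Longrightarrow> multilinear (- \<alpha>)"
  and multilinear_scale: "multilinear \<alpha> \<Longrightarrow> multilinear (c *\<^sub>F \<alpha>)"
  unfolding multilinear_def by (simp_all add: linear_iff scale_form_def algebra_simps)

lemma contract_add_vector:
  "multilinear \<alpha> \<Longrightarrow> contract (u + v) \<alpha> = contract u \<alpha> + contract v \<alpha>"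
  unfolding multilinear_def contract_def
  by (drule spec[of _ "[]"]) (simp add: linear_iff fun_eq_iff)

lemma contract_scale_vector:
  "multilinear \<alpha> \<Longrightarrow> contract (c *\<^sub>R u) \<alpha> = c *\<^sub>F contract u \<alpha>"
  unfolding multilinear_def contract_def
  by (drule spec[of _ "[]"]) (simp add: linear_iff fun_eq_iff scale_form_def)

lemma contract_minus_vector:
  "multilinear \<alpha> \<Longrightarrow> contract (- u) \<alpha> = - contract u \<alpha>"
  using contract_scale_vector[of \<alpha> "-1" u] by (simp add: scale_form_def fun_eq_iff)

lemma multilinear_wedge:
  assumes "multilinear \<alpha>" "multilinear \<beta>"
  shows "multilinear (\<alpha> \<and>\<^sub>F \<beta>)"
  unfolding multilinear_def
proof (intro allI)
  fix us ws
  show "linear (\<lambda>v. (\<alpha> \<and>\<^sub>F \<beta>) (us @ v # ws))"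
    using assms
  proof (induction us arbitrary: \<alpha> \<beta>)
    case Nil
    then show ?case
      by (simp add: linear_iff wedge_Cons contract_add_vector contract_scale_vector
          wedge_add_left wedge_add_right wedge_scale_left wedge_scale_right scale_form_apply
          algebra_simps)
  next
    case (Cons u us)
    then show ?case
      by (auto simp: wedge_Cons intro!: linear_compose_add multilinear_contract multilinear_grade)
  qed
qed

lemma alternating_contract:
  assumes "alternating \<alpha>"
  shows "alternating (contract x \<alpha>)"
proof (rule alternatingI)
  fix us v w ws
  show "contract x \<alpha> (us @ v # w # ws) = - contract x \<alpha> (us @ w # v # ws)"
    using alternatingD[OF assms, of "x # us" v w ws] by (simp add: contract_def)
qed

lemma alternating_grade:
  assumes "alternating \<alpha>"
  shows "alternating (grade \<alpha>)"
proof (rule alternatingI)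
  fix us v w ws
  show "grade \<alpha> (us @ v # w # ws) = - grade \<alpha> (us @ w # v # ws)"
    using alternatingD[OF assms, of us v w ws] by (simp add: grade_def)
qed

lemma alternating_add:
  assumes "alternating \<alpha>" "alternating \<beta>"
  shows "alternating (\<alpha> + \<beta>)"
proof (rule alternatingI)
  fix us v w ws
  show "(\<alpha> + \<beta>) (us @ v # w # ws) = - (\<alpha> + \<beta>) (us @ w # v # ws)"
    using alternatingD[OF assms(1), of us v w ws] alternatingD[OF assms(2), of us v w ws] by simp
qed

lemma alternating_scale:
  assumes "alternating \<alpha>"
  shows "alternating (c *\<^sub>F \<alpha>)"
proof (rule alternatingI)
  fix us v w ws
  show "(c *\<^sub>F \<alpha>) (us @ v # w # ws) = - (c *\<^sub>F \<alpha>) (us @ w # v # ws)"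
    using alternatingD[OF assms, of us v w ws] by (simp add: scale_form_def)
qed

lemma minus_form: "- \<alpha> = (-1) *\<^sub>F \<alpha>"
  by (simp add: scale_form_def fun_eq_iff)

lemma alternating_minus: "alternating \<alpha> \<Longrightarrow> alternating (- \<alpha>)"
  unfolding minus_form by (rule alternating_scale)

lemma contract_contract:
  assumes "alternating \<alpha>"
  shows "contract v (contract w \<alpha>) = - contract w (contract v \<alpha>)"
  using alternatingD[OF assms, of "[]" w v] by (simp add: contract_def fun_eq_iff)

text \<open>
  Behind a common prefix the claim is inherited from the factors by the recursion. At the front it
  says that contractions with \<open>v\<close> and with \<open>w\<close> anticommute on the product, which two antiderivations
  do as soon as they anticommute on both factors.
\<close>

lemma alternating_wedge:
  assumes "alternating \<alpha>" "alternating \<beta>"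
  shows "alternating (\<alpha> \<and>\<^sub>F \<beta>)"
proof (rule alternatingI)
  fix us v w ws
  show "(\<alpha> \<and>\<^sub>F \<beta>) (us @ v # w # ws) = - (\<alpha> \<and>\<^sub>F \<beta>) (us @ w # v # ws)"
    using assms
  proof (induction us arbitrary: \<alpha> \<beta>)
    case Nil
    then show ?case
      by (simp add: wedge_Cons contract_grade grade_grade wedge_minus_left
          contract_contract[of _ w v] wedge_minus_right)
  next
    case (Cons u us)
    have "(contract u \<alpha> \<and>\<^sub>F \<beta>) (us @ v # w # ws) = - (contract u \<alpha> \<and>\<^sub>F \<beta>) (us @ w # v # ws)"
      "(grade \<alpha> \<and>\<^sub>F contract u \<beta>) (us @ v # w # ws) = - (grade \<alpha> \<and>\<^sub>F contract u \<beta>) (us @ w # v # ws)"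
      by (intro Cons.IH alternating_contract alternating_grade Cons.prems)+
    then show ?case by (simp add: wedge_Cons)
  qed
qed

lemma has_degree_wedge:
  assumes "has_degree k \<alpha>" "has_degree l \<beta>"
  shows "has_degree (k + l) (\<alpha> \<and>\<^sub>F \<beta>)"
proof -
  have "(\<alpha> \<and>\<^sub>F \<beta>) vs = 0" if "length vs \<noteq> k + l" for vs
    using assms that
  proof (induction vs arbitrary: k l \<alpha> \<beta>)
    case Nil
    then show ?case by (auto simp: wedge_Nil has_degree_def)
  next
    case (Cons v vs)
    have "(contract v \<alpha> \<and>\<^sub>F \<beta>) vs = 0"
    proof (cases k)
      case 0
      then show ?thesis
        using Cons.prems by (simp add: has_degree_0_contract wedge_zero_left)
    next
      case (Suc m)
      then show ?thesis
        using Cons.prems has_degree_contract[of k \<alpha> v] by (intro Cons.IH[of m _ l]) auto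
    qed
    moreover have "(\<alpha> \<and>\<^sub>F contract v \<beta>) vs = 0"
    proof (cases l)
      case 0
      then show ?thesis
        using Cons.prems by (simp add: has_degree_0_contract wedge_zero_right)
    next
      case (Suc m)
      then show ?thesis
        using Cons.prems has_degree_contract[of l \<beta> v] by (intro Cons.IH[of k _ m]) auto
    qed
    ultimately show ?case
      using Cons.prems by (simp add: wedge_Cons grade_degree wedge_scale_left scale_form_apply)
  qed
  then show ?thesis by (simp add: has_degree_def)
qed

lemma is_form_wedge: "is_form k \<alpha> \<Longrightarrow> is_form l \<beta> \<Longrightarrow> is_form (k + l) (\<alpha> \<and>\<^sub>F \<beta>)"
  by (simp add: is_form_iff has_degree_wedge multilinear_wedge alternating_wedge)

lemma is_form_add: "is_form k \<alpha> \<Longrightarrow> is_form k \<beta> \<Longrightarrow> is_form k (\<alpha> + \<beta>)"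
  and is_form_minus: "is_form k \<alpha> \<Longrightarrow> is_form k (- \<alpha>)"
  and is_form_scale: "is_form k \<alpha> \<Longrightarrow> is_form k (c *\<^sub>F \<alpha>)"
  by (auto simp: is_form_iff multilinear_add multilinear_minus multilinear_scale
      alternating_add alternating_minus alternating_scale has_degree_def scale_form_apply)

lemma is_form_zero: "is_form k 0"
  by (simp add: is_form_iff multilinear_def alternating_def has_degree_def linear_iff)

lemma is_form_diff: "is_form k \<alpha> \<Longrightarrow> is_form k \<beta> \<Longrightarrow> is_form k (\<alpha> - \<beta>)"
  using is_form_add[OF _ is_form_minus, of k \<alpha> \<beta>] by simp

lemma is_form_sum: "(\<And>i. i \<in> I \<Longrightarrow> is_form k (\<alpha> i)) \<Longrightarrow> is_form k (\<Sum>i\<in>I. \<alpha> i)"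
  by (induction I rule: infinite_finite_induct) (auto simp: is_form_zero is_form_add)

text \<open>
  For a function supported on lists of length one, antisymmetry is vacuous.
\<close>

lemma is_form_1_iff:
  "is_form 1 \<alpha> \<longleftrightarrow> has_degree 1 \<alpha> \<and> linear (\<lambda>v. \<alpha> [v])"
proof -
  have "is_form 1 \<alpha>" if deg: "has_degree 1 \<alpha>" and lin: "linear (\<lambda>v. \<alpha> [v])"
  proof -
    have "linear (\<lambda>v. \<alpha> (vs[i := v]))" if "length vs = 1" "i < 1" for vs i
    proof -
      have "vs[i := v] = [v]" for v using that by (cases vs) auto
      then show ?thesis using lin by simp
    qed
    moreover have "\<alpha> vs = 0" if "\<not> distinct vs" for vs
    proof -
      have "length vs \<noteq> 1" using that by (auto simp: length_Suc_conv)
      then show ?thesis using deg by (simp add: has_degree_def)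
    qed
    ultimately show ?thesis using deg by (simp add: is_form_def has_degree_def)
  qed
  moreover have "linear (\<lambda>v. \<alpha> [v])" if "is_form 1 \<alpha>"
  proof -
    have "linear (\<lambda>v. \<alpha> ([] @ v # []))"
      using that unfolding is_form_iff multilinear_def by blast
    then show ?thesis by simp
  qed
  ultimately show ?thesis by (auto simp: is_form_iff)
qed


section \<open>The Chevalley--Eilenberg differential as an antiderivation\<close>

text \<open>
  The coadjoint action of \<open>v\<close>, extended to forms as a derivation.
\<close>

fun lie_derivative :: "('a \<Rightarrow> 'a \<Rightarrow> 'a) \<Rightarrow> 'a \<Rightarrow> 'a form \<Rightarrow> 'a form" where
  "lie_derivative br v \<alpha> [] = 0"
| "lie_derivative br v \<alpha> (w # ws) = lie_derivative br v (contract w \<alpha>) ws - \<alpha> (br v w # ws)"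

text \<open>
  Cartan's formula \<open>\<iota>\<^sub>v d \<alpha> = L\<^sub>v \<alpha> - d (\<iota>\<^sub>v \<alpha>)\<close>, read as a recursion over the arguments. It agrees with the
  Chevalley--Eilenberg differential on alternating forms, and unlike the double sum over pairs of
  positions it lends itself to induction.
\<close>

fun cartan_d :: "('a \<Rightarrow> 'a \<Rightarrow> 'a) \<Rightarrow> 'a form \<Rightarrow> 'a form" where
  "cartan_d br \<alpha> [] = 0"
| "cartan_d br \<alpha> (v # vs) = lie_derivative br v \<alpha> vs - cartan_d br (contract v \<alpha>) vs"

lemma contract_lie_derivative:
  "contract w (lie_derivative br v \<alpha>) = lie_derivative br v (contract w \<alpha>) - contract (br v w) \<alpha>"
  by (simp add: contract_def fun_eq_iff)

lemma contract_cartan_d: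
  "contract v (cartan_d br \<alpha>) = lie_derivative br v \<alpha> - cartan_d br (contract v \<alpha>)"
  by (simp add: contract_def fun_eq_iff)

lemma lie_derivative_add:
  "lie_derivative br v (\<alpha> + \<beta>) = lie_derivative br v \<alpha> + lie_derivative br v \<beta>"
proof
  show "lie_derivative br v (\<alpha> + \<beta>) vs = (lie_derivative br v \<alpha> + lie_derivative br v \<beta>) vs" for vs
    by (induction vs arbitrary: \<alpha> \<beta>) (simp_all add: contract_add)
qed

lemma lie_derivative_scale:
  "lie_derivative br v (c *\<^sub>F \<alpha>) = c *\<^sub>F lie_derivative br v \<alpha>"
proof
  show "lie_derivative br v (c *\<^sub>F \<alpha>) vs = (c *\<^sub>F lie_derivative br v \<alpha>) vs" for vs
    by (induction vs arbitrary: \<alpha>) (simp_all add: contract_scale scale_form_apply algebra_simps)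
qed

lemma cartan_d_add: "cartan_d br (\<alpha> + \<beta>) = cartan_d br \<alpha> + cartan_d br \<beta>"
proof
  show "cartan_d br (\<alpha> + \<beta>) vs = (cartan_d br \<alpha> + cartan_d br \<beta>) vs" for vs
    by (induction vs arbitrary: \<alpha> \<beta>) (simp_all add: contract_add lie_derivative_add)
qed

lemma cartan_d_scale: "cartan_d br (c *\<^sub>F \<alpha>) = c *\<^sub>F cartan_d br \<alpha>"
proof
  show "cartan_d br (c *\<^sub>F \<alpha>) vs = (c *\<^sub>F cartan_d br \<alpha>) vs" for vs
    by (induction vs arbitrary: \<alpha>)
      (simp_all add: contract_scale lie_derivative_scale scale_form_apply algebra_simps)
qed

lemma cartan_d_minus: "cartan_d br (- \<alpha>) = - cartan_d br \<alpha>"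
  unfolding minus_form by (rule cartan_d_scale)

lemma lie_derivative_minus: "lie_derivative br v (- \<alpha>) = - lie_derivative br v \<alpha>"
  unfolding minus_form by (rule lie_derivative_scale)

lemma lie_derivative_grade: "lie_derivative br v (grade \<alpha>) = grade (lie_derivative br v \<alpha>)"
proof
  show "lie_derivative br v (grade \<alpha>) vs = grade (lie_derivative br v \<alpha>) vs" for vs
    by (induction vs arbitrary: \<alpha>)
      (simp_all add: contract_grade lie_derivative_minus, simp_all add: grade_def algebra_simps)
qed

lemma cartan_d_grade: "cartan_d br (grade \<alpha>) = - grade (cartan_d br \<alpha>)"
proof
  show "cartan_d br (grade \<alpha>) vs = (- grade (cartan_d br \<alpha>)) vs" for vs
    by (induction vs arbitrary: \<alpha>)
      (simp_all add: contract_grade cartan_d_minus lie_derivative_grade,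
       simp_all add: grade_def algebra_simps)
qed

lemma lie_derivative_wedge:
  "lie_derivative br v (\<alpha> \<and>\<^sub>F \<beta>) =
    (lie_derivative br v \<alpha> \<and>\<^sub>F \<beta>) + (\<alpha> \<and>\<^sub>F lie_derivative br v \<beta>)"
proof
  show "lie_derivative br v (\<alpha> \<and>\<^sub>F \<beta>) vs =
    ((lie_derivative br v \<alpha> \<and>\<^sub>F \<beta>) + (\<alpha> \<and>\<^sub>F lie_derivative br v \<beta>)) vs" for vs
  proof (induction vs arbitrary: \<alpha> \<beta>)
    case Nil
    then show ?case by (simp add: wedge_Nil)
  next
    case (Cons w ws)
    then show ?case
      by (simp add: wedge_Cons contract_wedge lie_derivative_add contract_lie_derivative
          wedge_diff_left wedge_diff_right lie_derivative_grade)
  qed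
qed

text \<open>
  Contract both sides with \<open>w\<close>: by Cartan's formula, the derivation rule for \<open>L\<^sub>w\<close> and the antiderivation
  rule for \<open>\<iota>\<^sub>w\<close>, the difference of the two sides satisfies the same recursion with one argument less.
\<close>

theorem cartan_d_wedge:
  "cartan_d br (\<alpha> \<and>\<^sub>F \<beta>) = (cartan_d br \<alpha> \<and>\<^sub>F \<beta>) + (grade \<alpha> \<and>\<^sub>F cartan_d br \<beta>)"
proof
  show "cartan_d br (\<alpha> \<and>\<^sub>F \<beta>) vs =
    ((cartan_d br \<alpha> \<and>\<^sub>F \<beta>) + (grade \<alpha> \<and>\<^sub>F cartan_d br \<beta>)) vs" for vs
  proof (induction vs arbitrary: \<alpha> \<beta>)
    case Nil
    then show ?case by (simp add: wedge_Nil)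
  next
    case (Cons w ws)
    then show ?case
      by (simp add: wedge_Cons contract_wedge cartan_d_add contract_cartan_d lie_derivative_wedge
          wedge_diff_left wedge_diff_right cartan_d_grade contract_grade grade_grade
          wedge_minus_left wedge_minus_right)
  qed
qed

lemma lie_derivative_pullback:
  assumes "\<And>u v. q (br u v) = br' (q u) (q v)"
  shows "lie_derivative br v (pullback q \<alpha>) vs = lie_derivative br' (q v) \<alpha> (map q vs)"
proof (induction vs arbitrary: \<alpha>)
  case Nil
  then show ?case by simp
next
  case (Cons w ws)
  have "contract w (pullback q \<alpha>) = pullback q (contract (q w) \<alpha>)"
    by (simp add: contract_def pullback_def)
  then show ?case
    by (simp add: Cons.IH) (simp add: pullback_def assms)
qed

lemma cartan_d_pullback:
  assumes "\<And>u v. q (br u v) = br' (q u) (q v)"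
  shows "cartan_d br (pullback q \<alpha>) = pullback q (cartan_d br' \<alpha>)"
proof
  show "cartan_d br (pullback q \<alpha>) vs = pullback q (cartan_d br' \<alpha>) vs" for vs
  proof (induction vs arbitrary: \<alpha>)
    case Nil
    then show ?case by (simp add: pullback_def)
  next
    case (Cons w ws)
    have "contract w (pullback q \<alpha>) = pullback q (contract (q w) \<alpha>)"
      by (simp add: contract_def pullback_def)
    then show ?case
      by (simp add: Cons.IH lie_derivative_pullback[of q br br', OF assms]) (simp add: pullback_def)
  qed
qed

text \<open>
  The bracket that replaces the argument at position \<open>j\<close> is moved to the front, where the
  Chevalley--Eilenberg formula has it; this costs \<open>j\<close> transpositions.
\<close>

lemma lie_derivative_eq_sum:
  assumes "alternating \<alpha>"
  shows "lie_derivative br v \<alpha> vs =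
    (\<Sum>j<length vs. (-1) ^ Suc j * \<alpha> (br v (vs ! j) # nths vs (- {j})))"
  using assms
proof (induction vs arbitrary: \<alpha>)
  case Nil
  then show ?case by simp
next
  case (Cons w ws)
  have *: "nths (w # ws) (- {Suc j}) = w # nths ws (- {j})" for j
    by (simp add: nths_Cons Compl_eq)
  have 0: "nths (w # ws) (- {0}) = ws"
    by (simp add: nths_Cons nths_all Compl_eq)
  have "contract w \<alpha> (x # xs) = - \<alpha> (x # w # xs)" for x xs
    using alternatingD[OF Cons.prems, of "[]" w x xs] by (simp add: contract_def)
  then show ?case
    using Cons.IH[OF alternating_contract[OF Cons.prems], of w]
    by (simp add: lessThan_Suc_eq_insert_0 sum.insert sum.reindex * 0 del: sum.lessThan_Suc)
qed

text \<open>
  In the double sum over \<open>i < j\<close>, the terms with \<open>i = 0\<close> make up the Lie derivative along the first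
  argument \<open>v\<close>. In the others \<open>v\<close> stands right after the bracket, and exchanging the two gives minus the
  differential of the contraction.
\<close>

theorem ce_d_eq_cartan_d:
  assumes "alternating \<alpha>"
  shows "ce_d br \<alpha> = cartan_d br \<alpha>"
proof
  show "ce_d br \<alpha> vs = cartan_d br \<alpha> vs" for vs
    using assms
  proof (induction vs arbitrary: \<alpha>)
    case Nil
    then show ?case by (simp add: ce_d_def)
  next
    case (Cons v vs)
    have 0: "nths (v # vs) (- {0, Suc j}) = nths vs (- {j})" for j
      by (simp add: nths_Cons Compl_eq)
    have S: "nths (v # vs) (- {Suc i, Suc j}) = v # nths vs (- {i, j})" for i j
      by (simp add: nths_Cons Compl_eq)
    have alt: "\<alpha> (x # v # xs) = - contract v \<alpha> (x # xs)" for x xs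
      using alternatingD[OF Cons.prems, of "[]" x v xs] by (simp add: contract_def)
    have "ce_d br \<alpha> (v # vs) = (\<Sum>j<length vs.
        (-1) ^ Suc j * \<alpha> (br v (vs ! j) # nths vs (- {j})) +
        (\<Sum>i<j. (-1) ^ (i + j) * \<alpha> (br (vs ! i) (vs ! j) # v # nths vs (- {i, j}))))"
      by (simp add: ce_d_def lessThan_Suc_eq_insert_0 sum.reindex 0 S
          del: sum.lessThan_Suc)
    also have "\<dots> = lie_derivative br v \<alpha> vs - ce_d br (contract v \<alpha>) vs"
      by (simp add: sum.distrib lie_derivative_eq_sum[OF Cons.prems] ce_d_def alt sum_negf sum_subtractf)
    finally show ?case
      using Cons.IH[OF alternating_contract[OF Cons.prems]] by simp
  qed
qed

text \<open>
  The contraction of a form of degree 0 is zero, so in that case the recursion is cut off by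
  linearity.
\<close>

lemma has_degree_lie_derivative:
  assumes "has_degree k \<alpha>"
  shows "has_degree k (lie_derivative br v \<alpha>)"
proof -
  have "lie_derivative br v \<alpha> vs = 0" if "length vs \<noteq> k" for vs
    using assms that
  proof (induction vs arbitrary: k \<alpha>)
    case (Cons w ws)
    show ?case
    proof (cases k)
      case 0
      have "lie_derivative br v (contract w \<alpha>) ws = 0"
        using lie_derivative_scale[of br v 0 0] Cons.prems 0
        by (simp add: has_degree_0_contract scale_form_def zero_fun_def)
      then show ?thesis using Cons.prems 0 by (simp add: has_degree_def)
    next
      case (Suc m)
      then show ?thesis
        using Cons.prems Cons.IH[of m "contract w \<alpha>"] has_degree_contract[of k \<alpha> w]
        by (simp add: has_degree_def)
    qed
  qed simp
  then show ?thesis by (simp add: has_degree_def)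
qed

lemma has_degree_cartan_d:
  assumes "has_degree k \<alpha>"
  shows "has_degree (Suc k) (cartan_d br \<alpha>)"
proof -
  have "cartan_d br \<alpha> vs = 0" if "length vs \<noteq> Suc k" for vs
    using assms that
  proof (induction vs arbitrary: k \<alpha>)
    case (Cons w ws)
    have L: "lie_derivative br w \<alpha> ws = 0"
      using has_degree_lie_derivative[OF Cons.prems(1), of br w] Cons.prems(2)
      by (simp add: has_degree_def)
    show ?case
    proof (cases k)
      case 0
      have "cartan_d br (contract w \<alpha>) ws = 0"
        using cartan_d_scale[of br 0 0] Cons.prems 0
        by (simp add: has_degree_0_contract scale_form_def zero_fun_def)
      then show ?thesis using L by simp
    next
      case (Suc m)
      then show ?thesis
        using L Cons.prems Cons.IH[of m "contract w \<alpha>"] has_degree_contract[of k \<alpha> w] by simp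
    qed
  qed simp
  then show ?thesis by (simp add: has_degree_def)
qed

context
  fixes br :: "'a::real_vector \<Rightarrow> 'a \<Rightarrow> 'a"
  assumes lie: "lie_algebra br"
begin

lemma bracket_add: "br (x + y) z = br x z + br y z" "br z (x + y) = br z x + br z y"
  and bracket_scale: "br (c *\<^sub>R x) z = c *\<^sub>R br x z" "br z (c *\<^sub>R x) = c *\<^sub>R br z x"
  using lie by (auto simp: lie_algebra_def linear_iff)

lemma bracket_swap: "br x y = - br y x"
proof -
  have "br (x + y) (x + y) = 0" "br x x = 0" "br y y = 0"
    using lie unfolding lie_algebra_def by blast+
  then show ?thesis by (simp add: bracket_add eq_neg_iff_add_eq_0 add.commute)
qed

lemma multilinear_lie_derivative:
  assumes "multilinear \<alpha>"
  shows "multilinear (lie_derivative br v \<alpha>)"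
  unfolding multilinear_def
proof (intro allI)
  fix us ws
  show "linear (\<lambda>x. lie_derivative br v \<alpha> (us @ x # ws))"
    using assms
  proof (induction us arbitrary: \<alpha>)
    case Nil
    then show ?case
      by (simp add: linear_iff contract_add_vector contract_scale_vector lie_derivative_add
          lie_derivative_scale bracket_add bracket_scale form_Cons contract_lie_derivative scale_form_apply algebra_simps)
  next
    case (Cons u us)
    have "linear (\<lambda>x. \<alpha> ((br v u # us) @ x # ws))"
      using Cons.prems unfolding multilinear_def by blast
    then show ?case
      using Cons.IH[OF multilinear_contract[OF Cons.prems]] by (auto intro!: linear_compose_sub)
  qed
qed

lemma lie_derivative_add_vector:
  assumes "multilinear \<alpha>"
  shows "lie_derivative br (u + v) \<alpha> ws = lie_derivative br u \<alpha> ws + lie_derivative br v \<alpha> ws"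
  using assms
  by (induction ws arbitrary: \<alpha>)
    (simp_all add: multilinear_contract bracket_add form_Cons contract_lie_derivative contract_add_vector)

lemma lie_derivative_scale_vector:
  assumes "multilinear \<alpha>"
  shows "lie_derivative br (c *\<^sub>R u) \<alpha> ws = c * lie_derivative br u \<alpha> ws"
  using assms
  by (induction ws arbitrary: \<alpha>)
    (simp_all add: multilinear_contract bracket_scale form_Cons contract_lie_derivative contract_scale_vector
      scale_form_apply algebra_simps)

lemma multilinear_cartan_d:
  assumes "multilinear \<alpha>"
  shows "multilinear (cartan_d br \<alpha>)"
  unfolding multilinear_def
proof (intro allI)
  fix us ws
  show "linear (\<lambda>x. cartan_d br \<alpha> (us @ x # ws))"
    using assms
  proof (induction us arbitrary: \<alpha>)
    case Nil
    then show ?case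
      by (simp add: linear_iff contract_add_vector contract_scale_vector cartan_d_add
          cartan_d_scale lie_derivative_add_vector lie_derivative_scale_vector scale_form_apply
          algebra_simps)
  next
    case (Cons u us)
    have "linear (\<lambda>x. lie_derivative br u \<alpha> (us @ x # ws))"
      using multilinear_lie_derivative[OF Cons.prems] unfolding multilinear_def by blast
    then show ?case
      using Cons.IH[OF multilinear_contract[OF Cons.prems]] by (auto intro!: linear_compose_sub)
  qed
qed

lemma alternating_lie_derivative:
  assumes "alternating \<alpha>"
  shows "alternating (lie_derivative br v \<alpha>)"
proof (rule alternatingI)
  fix us a b ws
  show "lie_derivative br v \<alpha> (us @ a # b # ws) = - lie_derivative br v \<alpha> (us @ b # a # ws)"
    using assms
  proof (induction us arbitrary: \<alpha>)
    case Nil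
    then show ?case
      using alternatingD[OF Nil, of "[]" a "br v b" ws] alternatingD[OF Nil, of "[]" b "br v a" ws]
      by (simp add: contract_contract[of _ a b] lie_derivative_minus form_Cons contract_lie_derivative contract_diff)
  next
    case (Cons u us)
    show ?case
      using alternatingD[OF Cons.prems, of "br v u # us" a b ws]
        Cons.IH[OF alternating_contract[OF Cons.prems], of u] by simp
  qed
qed

lemma alternating_cartan_d:
  assumes "alternating \<alpha>" "multilinear \<alpha>"
  shows "alternating (cartan_d br \<alpha>)"
proof (rule alternatingI)
  fix us a b ws
  show "cartan_d br \<alpha> (us @ a # b # ws) = - cartan_d br \<alpha> (us @ b # a # ws)"
    using assms
  proof (induction us arbitrary: \<alpha>)
    case Nil
    then have "\<alpha> (br b a # ws) = - \<alpha> (br a b # ws)"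
      by (subst bracket_swap) (simp add: form_Cons contract_minus_vector)
    then show ?case
      using Nil by (simp add: contract_contract[of _ a b] cartan_d_minus)
  next
    case (Cons u us)
    show ?case
      using alternatingD[OF alternating_lie_derivative[OF Cons.prems(1)], of u us a b ws]
        Cons.IH[OF alternating_contract[OF Cons.prems(1)] multilinear_contract[OF Cons.prems(2)], of u]
      by simp
  qed
qed

lemma is_form_ce_d: "is_form k \<alpha> \<Longrightarrow> is_form (Suc k) (ce_d br \<alpha>)"
  by (simp add: is_form_iff ce_d_eq_cartan_d has_degree_cartan_d multilinear_cartan_d
      alternating_cartan_d)

end


section \<open>Coframes, dual frames and values on frames\<close>

text \<open>
  A coframe together with its dual basis. The last condition says that the \<open>v i\<close> span the space,
  which makes every multilinear function computable from its values on them.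
\<close>

definition frame :: "nat \<Rightarrow> (nat \<Rightarrow> ('a::real_vector) form) \<Rightarrow> (nat \<Rightarrow> 'a) \<Rightarrow> bool" where
  "frame n e v \<longleftrightarrow>
     (\<forall>i\<in>{1..n}. is_form 1 (e i)) \<and>
     (\<forall>i\<in>{1..n}. \<forall>j\<in>{1..n}. e i [v j] = (if i = j then 1 else 0)) \<and>
     (\<forall>x. x = (\<Sum>i\<in>{1..n}. e i [x] *\<^sub>R v i))"

lemma sum_form_apply: "(\<Sum>i\<in>I. \<alpha> i) vs = (\<Sum>i\<in>I. \<alpha> i vs)"
  by (induction I rule: infinite_finite_induct) auto

lemma linear_form_1: "is_form 1 \<alpha> \<Longrightarrow> linear (\<lambda>x. \<alpha> [x])"
  by (simp only: is_form_1_iff)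

lemma form_1_eqI:
  assumes "is_form 1 \<alpha>" "is_form 1 \<beta>" "\<And>x. \<alpha> [x] = \<beta> [x]"
  shows "\<alpha> = \<beta>"
proof
  fix vs
  show "\<alpha> vs = \<beta> vs"
  proof (cases "length vs = 1")
    case True
    then show ?thesis using assms(3) by (auto simp: length_Suc_conv)
  next
    case False
    then show ?thesis using assms by (simp add: is_form_def)
  qed
qed

text \<open>
  Induction on \<open>n\<close>. With dual vectors for the first \<open>n\<close> functionals, \<open>p\<close> projects along them onto the
  common kernel. If the next functional vanished on that kernel, it would be a combination of the
  previous ones; so it does not, and a suitable multiple \<open>w\<close> of some \<open>p x\<close> completes the dual system.
\<close>

lemma independent_functionals_dual_vectors:
  fixes f :: "nat \<Rightarrow> 'a::real_vector \<Rightarrow> real"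
  assumes lin: "\<And>i. i \<in> {1..n} \<Longrightarrow> linear (f i)"
    and ind: "\<And>c. (\<forall>x. (\<Sum>i\<in>{1..n}. c i * f i x) = 0) \<Longrightarrow> \<forall>i\<in>{1..n}. c i = 0"
  shows "\<exists>v. \<forall>i\<in>{1..n}. \<forall>j\<in>{1..n}. f i (v j) = (if i = j then 1 else 0)"
  using assms
proof (induction n)
  case 0
  then show ?case by simp
next
  case (Suc n)
  have last: "(\<Sum>i\<in>{1..Suc n}. (if i = Suc n then a else c i) * f i x) =
      (\<Sum>i\<in>{1..n}. c i * f i x) + a * f (Suc n) x" for a c x
  proof -
    have "(\<Sum>i\<in>{1..n}. (if i = Suc n then a else c i) * f i x) = (\<Sum>i\<in>{1..n}. c i * f i x)"
      by (rule sum.cong) auto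
    then show ?thesis by simp
  qed
  have "\<forall>i\<in>{1..n}. c i = 0" if "\<forall>x. (\<Sum>i\<in>{1..n}. c i * f i x) = 0" for c
  proof -
    have "\<forall>x. (\<Sum>i\<in>{1..Suc n}. (if i = Suc n then 0 else c i) * f i x) = 0"
      unfolding last using that by simp
    note 0 = Suc.prems(2)[OF this]
    show ?thesis
    proof
      fix i assume "i \<in> {1..n}"
      then show "c i = 0" using bspec[OF 0, of i] by (auto split: if_splits)
    qed
  qed
  then obtain v where v: "\<forall>i\<in>{1..n}. \<forall>j\<in>{1..n}. f i (v j) = (if i = j then 1 else 0)"
    using Suc.IH Suc.prems(1) by force
  define p where "p x = x - (\<Sum>j\<in>{1..n}. f j x *\<^sub>R v j)" for x
  have f_p: "f i (p x) = f i x - (\<Sum>j\<in>{1..n}. f j x * f i (v j))" if "i \<in> {1..Suc n}" for i x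
    using Suc.prems(1)[OF that] by (simp add: p_def linear_diff linear_sum linear_cmul)
  have "\<exists>x. f (Suc n) (p x) \<noteq> 0"
  proof (rule ccontr)
    assume "\<not> ?thesis"
    then have z: "f (Suc n) x = (\<Sum>j\<in>{1..n}. f j x * f (Suc n) (v j))" for x
      using f_p[of "Suc n" x] by (metis atLeastAtMost_iff diff_eq_diff_eq diff_self le_add1
          order_refl plus_1_eq_Suc)
    have "\<forall>x. (\<Sum>i\<in>{1..Suc n}. (if i = Suc n then 1 else - f (Suc n) (v i)) * f i x) = 0"
    proof
      fix x
      show "(\<Sum>i\<in>{1..Suc n}. (if i = Suc n then 1 else - f (Suc n) (v i)) * f i x) = 0"
        unfolding last using z[of x] by (simp add: sum_negf mult.commute)
    qed
    from bspec[OF Suc.prems(2)[OF this], of "Suc n"] show False by simp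
  qed
  then obtain x where x: "f (Suc n) (p x) \<noteq> 0" ..
  define w where "w = p x /\<^sub>R f (Suc n) (p x)"
  have w: "f i w = (if i = Suc n then 1 else 0)" if "i \<in> {1..Suc n}" for i
  proof (cases "i = Suc n")
    case True
    then show ?thesis
      using x linear_cmul[OF Suc.prems(1)[OF that]] by (simp add: w_def)
  next
    case False
    then have "i \<in> {1..n}" using that by auto
    then have "f i (p x) = 0"
      using v that by (simp add: f_p if_distrib[of "(*) _"] cong: if_cong)
    then show ?thesis
      using False linear_cmul[OF Suc.prems(1)[OF that]] by (simp add: w_def)
  qed
  define v' where "v' j = (if j = Suc n then w else v j - f (Suc n) (v j) *\<^sub>R w)" for j
  have "f i (v' j) = (if i = j then 1 else 0)" if "i \<in> {1..Suc n}" "j \<in> {1..Suc n}" for i j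
  proof (cases "j = Suc n")
    case True
    then show ?thesis using w[OF that(1)] by (simp add: v'_def)
  next
    case False
    have "f i (v' j) = f i (v j) - f (Suc n) (v j) * f i w"
      using False linear_diff[OF Suc.prems(1)[OF that(1)]] linear_cmul[OF Suc.prems(1)[OF that(1)]]
      by (simp add: v'_def)
    also have "\<dots> = (if i = j then 1 else 0)"
      using v False that w[OF that(1)] by (cases "i = Suc n") auto
    finally show ?thesis .
  qed
  then show ?case by blast
qed

text \<open>
  The dual vectors span: otherwise some \<open>x\<close> would differ from its expansion by a nonzero vector that
  every \<open>e j\<close> annihilates, hence every 1-form, whereas a nonzero vector extended to a basis is
  detected by a linear functional.
\<close>

lemma coframe_has_dual_frame:
  assumes "is_coframe n e"
  obtains v where "frame n e v"
proof -
  have form: "is_form 1 (e i)" if "i \<in> {1..n}" for i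
    using assms that by (simp add: is_coframe_def)
  have ind: "\<forall>i\<in>{1..n}. c i = 0" if "\<forall>x. (\<Sum>i\<in>{1..n}. c i * e i [x]) = 0" for c
  proof -
    have "(\<Sum>i\<in>{1..n}. c i *\<^sub>F e i) = 0"
      using that by (intro form_1_eqI is_form_sum is_form_scale form is_form_zero)
        (simp_all add: sum_form_apply scale_form_apply)
    then show ?thesis using assms unfolding is_coframe_def by blast
  qed
  obtain v where v: "\<forall>i\<in>{1..n}. \<forall>j\<in>{1..n}. e i [v j] = (if i = j then 1 else 0)"
    using independent_functionals_dual_vectors[of n "\<lambda>i x. e i [x]"] form linear_form_1 ind by blast
  have "x = (\<Sum>i\<in>{1..n}. e i [x] *\<^sub>R v i)" (is "x = ?s") for x
  proof (rule ccontr)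
    assume "x \<noteq> ?s"
    have e0: "e j [x - ?s] = 0" if "j \<in> {1..n}" for j
    proof -
      note lin = linear_form_1[OF form[OF that]]
      have "e j [?s] = (\<Sum>i\<in>{1..n}. e i [x] * (if j = i then 1 else 0))"
        unfolding linear_sum[OF lin] linear_cmul[OF lin] using v that by (intro sum.cong) auto
      then show ?thesis
        using that by (simp add: linear_diff[OF lin] if_distrib[of "(*) _"] cong: if_cong)
    qed
    obtain g :: "'a \<Rightarrow> real" where g: "linear g" "g (x - ?s) = 1"
      using linear_independent_extend[of "{x - ?s}" "\<lambda>_. 1::real"] \<open>x \<noteq> ?s\<close>
      by (auto simp: independent_insert)
    define \<alpha> where "\<alpha> = (\<lambda>vs. if length vs = 1 then g (hd vs) else 0)"
    have "is_form 1 \<alpha>"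
      unfolding is_form_1_iff using g(1) by (simp add: \<alpha>_def has_degree_def)
    then obtain c where "\<alpha> = (\<Sum>i\<in>{1..n}. c i *\<^sub>F e i)"
      using assms unfolding is_coframe_def by blast
    then have "\<alpha> [x - ?s] = (\<Sum>i\<in>{1..n}. c i * e i [x - ?s])"
      by (simp only: sum_form_apply scale_form_apply)
    also have "\<dots> = 0"
      by (intro sum.neutral ballI) (simp only: e0 mult_zero_right)
    finally show False using g(2) by (simp add: \<alpha>_def)
  qed
  then show thesis
    using that form v unfolding frame_def by blast
qed

lemma frame_form: "frame n e v \<Longrightarrow> i \<in> {1..n} \<Longrightarrow> is_form 1 (e i)"
  and frame_dual: "frame n e v \<Longrightarrow> i \<in> {1..n} \<Longrightarrow> j \<in> {1..n} \<Longrightarrow> e i [v j] = (if i = j then 1 else 0)"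
  and frame_expand: "frame n e v \<Longrightarrow> x = (\<Sum>i\<in>{1..n}. e i [x] *\<^sub>R v i)"
  unfolding frame_def by blast+

lemma frame_imp_coframe:
  assumes "frame n e v"
  shows "is_coframe n e"
  unfolding is_coframe_def
proof (intro conjI allI impI ballI)
  fix c i assume 0: "(\<Sum>i\<in>{1..n}. c i *\<^sub>F e i) = 0" and i: "i \<in> {1..n}"
  have "(\<Sum>i\<in>{1..n}. c i *\<^sub>F e i) [v i] = c i"
    using assms i by (simp add: sum_form_apply scale_form_apply frame_dual if_distrib[of "(*) _"] cong: if_cong)
  then show "c i = 0" using 0 by simp
next
  fix \<alpha> :: "'a form" assume \<alpha>: "is_form 1 \<alpha>"
  have "\<alpha> = (\<Sum>i\<in>{1..n}. \<alpha> [v i] *\<^sub>F e i)"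
  proof (rule form_1_eqI[OF \<alpha>])
    fix x
    have "\<alpha> [x] = \<alpha> [\<Sum>i\<in>{1..n}. e i [x] *\<^sub>R v i]"
      using frame_expand[OF assms] by metis
    then show "\<alpha> [x] = (\<Sum>i\<in>{1..n}. \<alpha> [v i] *\<^sub>F e i) [x]"
      by (simp add: sum_form_apply scale_form_apply linear_sum[OF linear_form_1[OF \<alpha>]]
          linear_cmul[OF linear_form_1[OF \<alpha>]] mult.commute)
  qed (intro is_form_sum is_form_scale frame_form[OF assms])
  then show "\<exists>c. \<alpha> = (\<Sum>i\<in>{1..n}. c i *\<^sub>F e i)" by (intro exI[of _ "\<lambda>i. \<alpha> [v i]"])
qed (rule frame_form[OF assms])

lemma dual_frame_eq:
  assumes "frame n e v" "i \<in> {1..n}"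
  shows "dual_frame n e i = v i"
  unfolding dual_frame_def
proof (rule the_equality)
  fix w assume w: "\<forall>j\<in>{1..n}. e j [w] = (if j = i then 1 else 0)"
  have "w = (\<Sum>j\<in>{1..n}. e j [w] *\<^sub>R v j)"
    by (rule frame_expand[OF assms(1)])
  also have "\<dots> = (\<Sum>j\<in>{1..n}. if j = i then v j else 0)"
    using w by (intro sum.cong) auto
  finally show "w = v i" using assms(2) by simp
qed (use assms frame_dual in force)

text \<open>
  The scalar \<open>s\<close> is a sign, but only its existence matters: it transports the vanishing of a form from
  sorted tuples to arbitrary ones.
\<close>

lemma alternating_insort:
  assumes "alternating \<alpha>"
  shows "\<exists>s. \<alpha> (map v (j # xs)) = s * \<alpha> (map v (insort j xs))"
  using assms
proof (induction xs arbitrary: \<alpha>)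
  case Nil
  then show ?case by (auto intro: exI[of _ 1])
next
  case (Cons x xs)
  show ?case
  proof (cases "j \<le> x")
    case True
    then show ?thesis by (auto intro: exI[of _ 1])
  next
    case False
    obtain s where "contract (v x) \<alpha> (map v (j # xs)) = s * contract (v x) \<alpha> (map v (insort j xs))"
      using Cons.IH[OF alternating_contract[OF Cons.prems]] by blast
    then show ?thesis
      using False alternatingD[OF Cons.prems, of "[]" "v j" "v x" "map v xs"]
      by (auto simp: contract_def intro!: exI[of _ "- s"])
  qed
qed

lemma alternating_sort:
  assumes "alternating \<alpha>"
  shows "\<exists>s. \<alpha> (map v js) = s * \<alpha> (map v (sort js))"
  using assms
proof (induction js arbitrary: \<alpha>)
  case Nil
  then show ?case by (auto intro: exI[of _ 1])
next
  case (Cons j js)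
  obtain s where "contract (v j) \<alpha> (map v js) = s * contract (v j) \<alpha> (map v (sort js))"
    using Cons.IH[OF alternating_contract[OF Cons.prems]] by blast
  moreover obtain t where "\<alpha> (map v (j # sort js)) = t * \<alpha> (map v (insort j (sort js)))"
    using alternating_insort[OF Cons.prems] by blast
  ultimately show ?case
    by (auto simp: contract_def intro!: exI[of _ "s * t"])
qed

lemma multilinear_zero_on_frame:
  assumes "multilinear \<alpha>" "frame n e v" "\<And>js. set js \<subseteq> {1..n} \<Longrightarrow> \<alpha> (map v js) = 0"
  shows "\<alpha> vs = 0"
  using assms(1,3)
proof (induction vs arbitrary: \<alpha>)
  case Nil
  from Nil.prems(2)[of "[]"] show ?case by simp
next
  case (Cons x xs)
  have zero: "contract (v j) \<alpha> xs = 0" if "j \<in> {1..n}" for j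
  proof (rule Cons.IH[OF multilinear_contract[OF Cons.prems(1)]])
    fix js assume "set js \<subseteq> {1..n}"
    then show "contract (v j) \<alpha> (map v js) = 0"
      using that Cons.prems(2)[of "j # js"] by (simp add: contract_def)
  qed
  have lin: "linear (\<lambda>y. \<alpha> (y # xs))"
    using Cons.prems(1)[unfolded multilinear_def, rule_format, of "[]" xs] by simp
  have "\<alpha> (x # xs) = \<alpha> ((\<Sum>j\<in>{1..n}. e j [x] *\<^sub>R v j) # xs)"
    using frame_expand[OF assms(2)] by metis
  also have "\<dots> = (\<Sum>j\<in>{1..n}. e j [x] * contract (v j) \<alpha> xs)"
    unfolding linear_sum[OF lin] linear_cmul[OF lin] by (simp add: contract_def)
  also have "\<dots> = 0"
    by (intro sum.neutral ballI) (simp only: zero mult_zero_right)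
  finally show ?case .
qed

lemma subseqs_sorted:
  "js \<in> set (subseqs xs) \<Longrightarrow> sorted_wrt (<) xs \<Longrightarrow> sorted_wrt (<) js \<and> set js \<subseteq> set xs"
proof (induction xs arbitrary: js)
  case (Cons x xs)
  then show ?case by (fastforce simp: Let_def)
qed simp

lemma strictly_sorted_in_subseqs:
  "sorted_wrt (<) js \<Longrightarrow> set js \<subseteq> {m..<n} \<Longrightarrow> js \<in> set (subseqs [m..<n])" for js :: "nat list"
proof (induction "n - m" arbitrary: m js)
  case 0
  then show ?case by simp
next
  case (Suc k)
  then have upt: "[m..<n] = m # [Suc m..<n]" by (simp add: upt_conv_Cons)
  show ?case
  proof (cases "m \<in> set js")
    case True
    then obtain ks where js: "js = m # ks"
      using Suc.prems by (cases js) fastforce+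
    have "ks \<in> set (subseqs [Suc m..<n])"
      using Suc.prems Suc.hyps(2) by (intro Suc.hyps(1)) (auto simp: js subset_iff Suc_le_eq)
    then show ?thesis by (simp add: upt js Let_def)
  next
    case False
    have "m < x" if "x \<in> set js" for x
      using False that Suc.prems(2) by (cases "x = m") (auto simp: subset_iff)
    then have "js \<in> set (subseqs [Suc m..<n])"
      using Suc.prems Suc.hyps(2) by (intro Suc.hyps(1)) (auto simp: subset_iff Suc_le_eq)
    then show ?thesis by (simp add: upt Let_def)
  qed
qed

text \<open>
  By multilinearity and antisymmetry a form is determined by its values on strictly increasing
  tuples of frame vectors. The tuples are listed by \<open>subseqs\<close> so that for given numbers the premise
  evaluates to a finite conjunction.
\<close>

theorem form_eq_on_frameI:
  assumes "is_form k \<alpha>" "is_form k \<beta>" "frame n e v"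
    and eq: "\<forall>js \<in> set (subseqs [1..<Suc n]). length js = k \<longrightarrow> \<alpha> (map v js) = \<beta> (map v js)"
  shows "\<alpha> = \<beta>"
proof -
  define \<gamma> where "\<gamma> = \<alpha> - \<beta>"
  have \<gamma>: "is_form k \<gamma>" using assms by (simp add: \<gamma>_def is_form_diff)
  have "\<gamma> (map v js) = 0" if "set js \<subseteq> {1..n}" for js
  proof -
    obtain s where s: "\<gamma> (map v js) = s * \<gamma> (map v (sort js))"
      using alternating_sort \<gamma> unfolding is_form_iff by blast
    have "\<gamma> (map v (sort js)) = 0"
    proof (cases "length js = k \<and> distinct js")
      case True
      then have "sort js \<in> set (subseqs [1..<Suc n])"
        using that by (intro strictly_sorted_in_subseqs) (auto simp: strict_sorted_iff)
      then show ?thesis using eq True by (simp add: \<gamma>_def)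
    next
      case False
      then show ?thesis using \<gamma> by (auto simp: is_form_def distinct_map)
    qed
    then show ?thesis using s by simp
  qed
  then have "\<gamma> vs = 0" for vs
    using multilinear_zero_on_frame[OF _ assms(3)] \<gamma> unfolding is_form_iff by blast
  then show ?thesis by (simp add: \<gamma>_def fun_eq_iff)
qed


section \<open>Calculus of 1-forms and the Hodge star\<close>

lemma contract_unit: "contract v unit_form = 0"
  by (simp add: contract_def unit_form_def fun_eq_iff)

lemma wedge_unit_left: "unit_form \<and>\<^sub>F \<beta> = \<beta>" for \<beta> :: "'a form"
proof
  have "grade unit_form = (unit_form :: 'a form)"
    by (simp add: grade_def unit_form_def fun_eq_iff)
  then show "(unit_form \<and>\<^sub>F \<beta>) vs = \<beta> vs" for vs
  proof (induction vs arbitrary: \<beta>)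
    case Nil
    show ?case by (simp add: wedge_Nil) (simp add: unit_form_def)
  next
    case (Cons v vs)
    then show ?case by (simp add: wedge_Cons contract_unit wedge_zero_left) (simp add: contract_def)
  qed
qed

lemma wedge_unit_right: "\<alpha> \<and>\<^sub>F unit_form = \<alpha>" for \<alpha> :: "'a form"
proof
  show "(\<alpha> \<and>\<^sub>F unit_form) vs = \<alpha> vs" for vs
  proof (induction vs arbitrary: \<alpha>)
    case Nil
    show ?case by (simp add: wedge_Nil) (simp add: unit_form_def)
  next
    case (Cons v vs)
    then show ?case by (simp add: wedge_Cons contract_unit wedge_zero_right) (simp add: contract_def)
  qed
qed

lemma contract_1: "is_form 1 \<alpha> \<Longrightarrow> contract x \<alpha> = \<alpha> [x] *\<^sub>F unit_form"
  unfolding is_form_iff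
  by (auto simp: contract_def unit_form_def scale_form_def has_degree_def fun_eq_iff)

lemma grade_1: "is_form 1 \<alpha> \<Longrightarrow> grade \<alpha> = - \<alpha>"
  using grade_degree[of 1 \<alpha>] by (simp add: is_form_iff minus_form)

lemma contract_1_wedge:
  "is_form 1 \<alpha> \<Longrightarrow> contract x (\<alpha> \<and>\<^sub>F \<beta>) = \<alpha> [x] *\<^sub>F \<beta> - (\<alpha> \<and>\<^sub>F contract x \<beta>)"
  by (simp add: contract_wedge contract_1 grade_1 wedge_scale_left wedge_unit_left wedge_minus_left)

lemma wedge_1_Cons:
  "is_form 1 \<alpha> \<Longrightarrow> (\<alpha> \<and>\<^sub>F \<beta>) (x # xs) = \<alpha> [x] * \<beta> xs - (\<alpha> \<and>\<^sub>F contract x \<beta>) xs"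
  by (simp add: form_Cons[of "\<alpha> \<and>\<^sub>F \<beta>"] contract_1_wedge scale_form_apply)

lemma wedge_1_swap:
  assumes "is_form 1 \<alpha>" "is_form 1 \<beta>"
  shows "\<beta> \<and>\<^sub>F \<alpha> = - (\<alpha> \<and>\<^sub>F \<beta>)"
  using wedge_commute[of 1 \<beta> 1 \<alpha>] assms by (simp add: is_form_iff minus_form)

lemma wedge_1_self: "is_form 1 \<alpha> \<Longrightarrow> \<alpha> \<and>\<^sub>F \<alpha> = 0"
  using wedge_1_swap[of \<alpha> \<alpha>] by (simp add: fun_eq_iff)

lemma wedge_1_swap_left:
  assumes "is_form 1 \<alpha>" "is_form 1 \<beta>"
  shows "\<beta> \<and>\<^sub>F \<alpha> \<and>\<^sub>F \<gamma> = - (\<alpha> \<and>\<^sub>F \<beta> \<and>\<^sub>F \<gamma>)"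
  using wedge_assoc[of \<beta> \<alpha> \<gamma>] wedge_assoc[of \<alpha> \<beta> \<gamma>]
  by (simp add: wedge_1_swap[OF assms] wedge_minus_left)

lemma wedge_1_self_left: "is_form 1 \<alpha> \<Longrightarrow> \<alpha> \<and>\<^sub>F \<alpha> \<and>\<^sub>F \<gamma> = 0"
  using wedge_assoc[of \<alpha> \<alpha> \<gamma>] by (simp add: wedge_1_self wedge_zero_left)

lemma scale_add: "a *\<^sub>F (\<alpha> + \<beta>) = a *\<^sub>F \<alpha> + a *\<^sub>F \<beta>"
  and scale_diff: "a *\<^sub>F (\<alpha> - \<beta>) = a *\<^sub>F \<alpha> - a *\<^sub>F \<beta>"
  and scale_minus: "a *\<^sub>F (- \<alpha>) = - (a *\<^sub>F \<alpha>)"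
  and scale_zero: "a *\<^sub>F 0 = 0" and zero_scale: "0 *\<^sub>F \<alpha> = 0" and one_scale: "1 *\<^sub>F \<alpha> = \<alpha>"
  by (simp_all add: scale_form_def fun_eq_iff algebra_simps)

lemmas wedge_linear = wedge_add_left wedge_add_right wedge_diff_left wedge_diff_right
  wedge_minus_left wedge_minus_right wedge_scale_left wedge_scale_right
  wedge_zero_left wedge_zero_right scale_add scale_diff scale_minus scale_zero

text \<open>
  Used as rewrite rules, these bring a product of members of a coframe into increasing order; at
  concrete indices the condition \<open>j < i\<close> is decided by evaluation.
\<close>

lemma wedge_sort:
  assumes "frame n e v"
  shows "i \<in> {1..n} \<Longrightarrow> j \<in> {1..n} \<Longrightarrow> j < i \<Longrightarrow> e i \<and>\<^sub>F e j = - (e j \<and>\<^sub>F e i)"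
    and "i \<in> {1..n} \<Longrightarrow> j \<in> {1..n} \<Longrightarrow> j < i \<Longrightarrow> e i \<and>\<^sub>F e j \<and>\<^sub>F \<gamma> = - (e j \<and>\<^sub>F e i \<and>\<^sub>F \<gamma>)"
    and "i \<in> {1..n} \<Longrightarrow> e i \<and>\<^sub>F e i = 0"
    and "i \<in> {1..n} \<Longrightarrow> e i \<and>\<^sub>F e i \<and>\<^sub>F \<gamma> = 0"
  using frame_form[OF assms]
  by (blast intro: wedge_1_swap wedge_1_swap_left wedge_1_self wedge_1_self_left)+

text \<open>
  Contracting with the frame vectors one after the other, the factor \<open>e i\<close> only picks up \<open>v i\<close>; the sign
  counts the vectors before it.
\<close>

lemma wedge_frame_eval:
  assumes "frame n e v" "i \<in> {1..n}" "set js \<subseteq> {1..n}" "distinct js"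
  shows "(e i \<and>\<^sub>F \<beta>) (map v js) =
    (if i \<in> set js then (-1) ^ length (takeWhile (\<lambda>j. j \<noteq> i) js) * \<beta> (map v (remove1 i js)) else 0)"
  using assms(3,4)
proof (induction js arbitrary: \<beta>)
  case Nil
  then show ?case
    using frame_form[OF assms(1,2)] by (simp add: wedge_Nil is_form_def)
next
  case (Cons j js)
  have "(e i \<and>\<^sub>F \<beta>) (map v (j # js)) =
      (if i = j then 1 else 0) * \<beta> (map v js) - (e i \<and>\<^sub>F contract (v j) \<beta>) (map v js)"
    using Cons.prems frame_dual[OF assms(1,2), of j]
    by (simp add: wedge_1_Cons[OF frame_form[OF assms(1,2)]])
  then show ?case
    using Cons by (auto simp: contract_def)
qed

lemma is_form_frame_product:
  assumes "frame n e v" "set K \<subseteq> {1..n}"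
  shows "is_form (length K) (foldr wedge (map e K) unit_form)"
  using assms(2)
proof (induction K)
  case Nil
  then show ?case
    by (simp add: is_form_def unit_form_def)
next
  case (Cons k K)
  then show ?case
    using is_form_wedge[OF frame_form[OF assms(1)], of k "length K"] by simp
qed

text \<open>
  The products of increasing members of the coframe form a basis dual to the increasing tuples of
  frame vectors.
\<close>

lemma frame_product_eval:
  assumes "frame n e v" "set K \<subseteq> {1..n}" "set I \<subseteq> {1..n}" "sorted_wrt (<) K" "sorted_wrt (<) I"
  shows "foldr wedge (map e K) unit_form (map v I) = (if I = K then 1 else 0)"
  using assms(2-5)
proof (induction K arbitrary: I)
  case Nil
  then show ?case by (simp add: unit_form_def)
next
  case (Cons k K)
  have dist: "distinct I"
    using Cons.prems(4) strict_sorted_iff by blast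
  have srt: "sorted_wrt (<) (remove1 k I)"
    using Cons.prems(4) by (simp add: strict_sorted_iff sorted_remove1)
  have "foldr wedge (map e (k # K)) unit_form (map v I) =
      (if k \<in> set I then (-1) ^ length (takeWhile (\<lambda>j. j \<noteq> k) I) *
        foldr wedge (map e K) unit_form (map v (remove1 k I)) else 0)"
    using Cons.prems dist wedge_frame_eval[OF assms(1), of k I] by simp
  also have "foldr wedge (map e K) unit_form (map v (remove1 k I)) = (if remove1 k I = K then 1 else 0)"
    using Cons.prems srt set_remove1_subset[of k I] by (intro Cons.IH) auto
  \<comment> \<open>as \<open>k\<close> is below all of \<open>K\<close>, removing it from the sorted list \<open>I\<close> gives \<open>K\<close> only if it is the head, and then the sign is 1\<close>
  also have "(if k \<in> set I then (-1) ^ length (takeWhile (\<lambda>j. j \<noteq> k) I) *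
        (if remove1 k I = K then 1 else 0) else 0 :: real) = (if I = k # K then 1 else 0)"
  proof (cases "k \<in> set I \<and> remove1 k I = K")
    case True
    have "I = k # K"
    proof (cases I)
      case Nil
      then show ?thesis using True by simp
    next
      case (Cons i I')
      then show ?thesis
        using True Cons.prems \<open>sorted_wrt (<) (k # K)\<close> \<open>sorted_wrt (<) I\<close>
        by (cases "i = k") fastforce+
    qed
    then show ?thesis by simp
  next
    case False
    then show ?thesis by auto
  qed
  finally show ?case .
qed

lemma form_inner_frame_product:
  assumes "frame n e v" "set K \<subseteq> {1..n}" "sorted_wrt (<) K"
  shows "form_inner n e (foldr wedge (map e K) unit_form) \<beta> = \<beta> (map v K)"
proof -
  have "form_inner n e (foldr wedge (map e K) unit_form) \<beta> =
      (\<Sum>I\<in>Pow {1..n}. if I = set K then \<beta> (map v K) else 0)"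
    unfolding form_inner_def
  proof (rule sum.cong[OF refl])
    fix I assume I: "I \<in> Pow {1..n}"
    then have fin: "finite I" using finite_subset by auto
    have dual: "map (dual_frame n e) (sorted_list_of_set I) = map v (sorted_list_of_set I)"
      using I fin dual_frame_eq[OF assms(1)] by auto
    have eq: "sorted_list_of_set I = K \<longleftrightarrow> I = set K"
      using assms(3) fin by (metis set_sorted_list_of_set sorted_list_of_set.idem_if_sorted_distinct
          strict_sorted_iff)
    have "foldr wedge (map e K) unit_form (map v (sorted_list_of_set I)) = (if I = set K then 1 else 0)"
      using frame_product_eval[OF assms(1,2) _ assms(3), of "sorted_list_of_set I"] I fin
      unfolding eq by simp
    then show "foldr wedge (map e K) unit_form (map (dual_frame n e) (sorted_list_of_set I)) *
        \<beta> (map (dual_frame n e) (sorted_list_of_set I)) = (if I = set K then \<beta> (map v K) else 0)"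
      unfolding dual using eq by auto
  qed
  then show ?thesis
    using assms(2) by simp
qed

lemma foldr_wedge: "foldr wedge as \<beta> = foldr wedge as unit_form \<and>\<^sub>F \<beta>" for \<beta> :: "'a form"
  by (induction as) (simp_all add: wedge_unit_left wedge_assoc)

text \<open>
  The defining property of the star, tested on the basis form of \<open>K\<close> and evaluated on the whole frame:
  the inner product with a basis form reads off a coefficient, and the volume form takes the value
  1. For given \<open>K\<close> the left-hand side is, up to sign, the value of \<open>\<gamma>\<close> on the tuple complementary to \<open>K\<close>.
\<close>

theorem hodge_star_eval:
  assumes "frame n e v" "is_hodge_star n e (length K) \<beta> \<gamma>" "set K \<subseteq> {1..n}" "sorted_wrt (<) K"
  shows "foldr wedge (map e K) \<gamma> (map v [1..<Suc n]) = \<beta> (map v K)"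
proof -
  have "volume_form n e (map v [1..<Suc n]) = 1"
    unfolding volume_form_def using frame_product_eval[OF assms(1), of "[1..<Suc n]" "[1..<Suc n]"]
    by (simp add: atLeastLessThanSuc_atLeastAtMost del: upt_Suc)
  moreover have "foldr wedge (map e K) unit_form \<and>\<^sub>F \<gamma> = \<beta> (map v K) *\<^sub>F volume_form n e"
    using assms(2) is_form_frame_product[OF assms(1,3)] form_inner_frame_product[OF assms(1,3,4)]
    unfolding is_hodge_star_def by simp
  ultimately show ?thesis
    by (subst foldr_wedge) (simp add: scale_form_apply del: upt_Suc)
qed


section \<open>The fundamental forms of a \<open>G\<^sub>2\<close>-structure\<close>

definition g2_form :: "(nat \<Rightarrow> 'a form) \<Rightarrow> 'a form" where
  "g2_form e = (e 1 \<and>\<^sub>F e 2 \<and>\<^sub>F e 7) + (e 3 \<and>\<^sub>F e 4 \<and>\<^sub>F e 7) + (e 5 \<and>\<^sub>F e 6 \<and>\<^sub>F e 7)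
       + (e 1 \<and>\<^sub>F e 3 \<and>\<^sub>F e 5) - (e 1 \<and>\<^sub>F e 4 \<and>\<^sub>F e 6)
       - (e 2 \<and>\<^sub>F e 3 \<and>\<^sub>F e 6) - (e 2 \<and>\<^sub>F e 4 \<and>\<^sub>F e 5)"

definition g2_dual_form :: "(nat \<Rightarrow> 'a form) \<Rightarrow> 'a form" where
  "g2_dual_form e = (e 3 \<and>\<^sub>F e 4 \<and>\<^sub>F e 5 \<and>\<^sub>F e 6) + (e 1 \<and>\<^sub>F e 2 \<and>\<^sub>F e 5 \<and>\<^sub>F e 6)
       + (e 1 \<and>\<^sub>F e 2 \<and>\<^sub>F e 3 \<and>\<^sub>F e 4) - (e 2 \<and>\<^sub>F e 4 \<and>\<^sub>F e 6 \<and>\<^sub>F e 7)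
       + (e 2 \<and>\<^sub>F e 3 \<and>\<^sub>F e 5 \<and>\<^sub>F e 7) + (e 1 \<and>\<^sub>F e 4 \<and>\<^sub>F e 5 \<and>\<^sub>F e 7)
       + (e 1 \<and>\<^sub>F e 3 \<and>\<^sub>F e 6 \<and>\<^sub>F e 7)"

lemma is_form_wedge2: "is_form 1 a \<Longrightarrow> is_form 1 b \<Longrightarrow> is_form 2 (a \<and>\<^sub>F b)"
  and is_form_wedge3: "is_form 1 a \<Longrightarrow> is_form 2 \<beta> \<Longrightarrow> is_form 3 (a \<and>\<^sub>F \<beta>)"
  and is_form_wedge4: "is_form 1 a \<Longrightarrow> is_form 3 \<gamma> \<Longrightarrow> is_form 4 (a \<and>\<^sub>F \<gamma>)"
  using is_form_wedge[of 1 a 1 b] is_form_wedge[of 1 a 2 \<beta>] is_form_wedge[of 1 a 3 \<gamma>]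
  by (simp_all add: numeral_eq_Suc)

lemmas is_form_intros = is_form_add is_form_diff is_form_minus is_form_scale
  is_form_wedge2 is_form_wedge3 is_form_wedge4

lemma frame_dual_map:
  "frame n e v \<Longrightarrow> i \<in> {1..n} \<Longrightarrow> j \<in> {1..n} \<Longrightarrow> e i (map v [j]) = (if i = j then 1 else 0)"
  by (simp add: frame_dual)

text \<open>
  The 35 instances of \<open>hodge_star_eval\<close> for a 3-form in dimension seven give the values of the dual
  4-form on all increasing 4-tuples of frame vectors.
\<close>

theorem hodge_star_g2_form:
  assumes frame: "frame 7 e v" and star: "is_hodge_star 7 e 3 (g2_form e) \<Phi>"
  shows "\<Phi> = g2_dual_form e"
proof (rule form_eq_on_frameI[OF _ _ frame])
  show "is_form 4 \<Phi>"
    using star by (simp add: is_hodge_star_def)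
  show "is_form 4 (g2_dual_form e)"
    unfolding g2_dual_form_def by (intro is_form_intros frame_form[OF frame]) auto
  have sub: "set K \<subseteq> {1..7} \<and> sorted_wrt (<) K" if "K \<in> set (subseqs [1..<8])" for K
    using subseqs_sorted[OF that] by auto
  have "\<forall>K\<in>set (subseqs [1..<8]). length K = 3 \<longrightarrow>
      foldr wedge (map e K) \<Phi> (map v [1..<8]) = g2_form e (map v K)"
    using hodge_star_eval[OF frame, of _ "g2_form e" \<Phi>] star sub by simp
  then show "\<forall>K\<in>set (subseqs [1..<Suc 7]). length K = 4 \<longrightarrow> \<Phi> (map v K) = g2_dual_form e (map v K)"
    unfolding g2_form_def g2_dual_form_def
    by (simp add: Let_def upt_rec wedge_frame_eval[OF frame] frame_dual_map[OF frame]
        list.map[where f = e] del: list.map One_nat_def)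
qed


text \<open>
  With \<open>c\<^sup>2 + s\<^sup>2 = 1\<close> this is a rotation in the plane of the indices \<open>p\<close> and \<open>q\<close>.
\<close>

definition rotate_coframe :: "nat \<Rightarrow> nat \<Rightarrow> real \<Rightarrow> real \<Rightarrow> (nat \<Rightarrow> 'a form) \<Rightarrow> nat \<Rightarrow> 'a form" where
  "rotate_coframe p q c s e = e(p := c *\<^sub>F e p + s *\<^sub>F e q, q := c *\<^sub>F e q - s *\<^sub>F e p)"

lemma sum_split_pair:
  fixes f :: "nat \<Rightarrow> 'c::comm_monoid_add"
  assumes "p \<in> {1..n}" "q \<in> {1..n}" "p \<noteq> q"
  shows "(\<Sum>i\<in>{1..n}. f i) = f p + f q + (\<Sum>i\<in>{1..n} - {p, q}. f i)"
  using sum.subset_diff[of "{p, q}" "{1..n}" f] assms by (simp add: add.commute)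

lemma frame_rotate:
  assumes frame: "frame n e v" and pq: "p \<in> {1..n}" "q \<in> {1..n}" "p \<noteq> q" and cs: "c * c + s * s = 1"
  shows "frame n (rotate_coframe p q c s e)
    (v(p := c *\<^sub>R v p + s *\<^sub>R v q, q := c *\<^sub>R v q - s *\<^sub>R v p))"
    (is "frame n ?e ?v")
  unfolding frame_def
proof (intro conjI ballI allI)
  fix i j assume ij: "i \<in> {1..n}" "j \<in> {1..n}"
  note form = frame_form[OF frame]
  show "is_form 1 (?e i)"
    using form ij pq by (auto simp: rotate_coframe_def intro!: is_form_add is_form_diff is_form_scale)
  have lin: "e k [a *\<^sub>R x + b *\<^sub>R y] = a * e k [x] + b * e k [y]"
    "e k [a *\<^sub>R x - b *\<^sub>R y] = a * e k [x] - b * e k [y]" if "k \<in> {1..n}" for k a b x y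
  proof -
    note l = linear_form_1[OF form[OF that]]
    show "e k [a *\<^sub>R x + b *\<^sub>R y] = a * e k [x] + b * e k [y]"
      "e k [a *\<^sub>R x - b *\<^sub>R y] = a * e k [x] - b * e k [y]"
      using linear_add[OF l] linear_diff[OF l] linear_cmul[OF l] by simp_all
  qed
  show "?e i [?v j] = (if i = j then 1 else 0)"
    using ij pq cs frame_dual[OF frame]
    by (auto simp: rotate_coframe_def lin scale_form_apply algebra_simps)
next
  fix x :: 'a
  let ?t = "\<lambda>(e :: nat \<Rightarrow> 'a form) v i. e i [x] *\<^sub>R (v i :: 'a)"
  have "(\<Sum>i\<in>{1..n} - {p, q}. ?t ?e ?v i) = (\<Sum>i\<in>{1..n} - {p, q}. ?t e v i)"
    by (rule sum.cong) (auto simp: rotate_coframe_def)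
  moreover have "?t ?e ?v p + ?t ?e ?v q = (c * c + s * s) *\<^sub>R ?t e v p + (c * c + s * s) *\<^sub>R ?t e v q"
    using pq by (simp add: rotate_coframe_def scale_form_apply algebra_simps)
  ultimately have "(\<Sum>i\<in>{1..n}. ?t ?e ?v i) = (\<Sum>i\<in>{1..n}. ?t e v i)"
    unfolding sum_split_pair[OF pq] cs by simp
  then show "x = (\<Sum>i\<in>{1..n}. ?t ?e ?v i)"
    using frame_expand[OF frame, of x] by metis
qed

lemma coframe_metric_rotate:
  assumes pq: "p \<in> {1..n}" "q \<in> {1..n}" "p \<noteq> q" and cs: "c * c + s * s = 1"
  shows "coframe_metric n (rotate_coframe p q c s e) x y = coframe_metric n e x y"
proof -
  let ?e = "rotate_coframe p q c s e"
  have "(\<Sum>i\<in>{1..n} - {p, q}. ?e i [x] * ?e i [y]) = (\<Sum>i\<in>{1..n} - {p, q}. e i [x] * e i [y])"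
    by (rule sum.cong) (auto simp: rotate_coframe_def)
  moreover have "?e p [x] * ?e p [y] + ?e q [x] * ?e q [y] =
      (c * c + s * s) * (e p [x] * e p [y]) + (c * c + s * s) * (e q [x] * e q [y])"
    using pq by (simp add: rotate_coframe_def scale_form_apply algebra_simps)
  ultimately show ?thesis
    unfolding coframe_metric_def sum_split_pair[OF pq] cs by simp
qed

section \<open>Transitivity of \<open>G\<^sub>2\<close> on unit vectors\<close>

text \<open>
  Pairs of planes \<open>(p, q)\<close>, \<open>(r, t)\<close> such that simultaneous rotation by the same angle in both lies in
  \<open>G\<^sub>2\<close>. For each, the three remaining indices occur together in one of the seven terms of the 3-form;
  that term is fixed, and the other six group into its three factors, each wedged with a 2-form in the
  four rotated directions that the double rotation preserves. The order of \<open>r\<close> and \<open>t\<close> fixes the sense of the second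
  rotation. The pairs are listed in the order in which they are used to turn a vector into the
  seventh direction.
\<close>

definition g2_planes :: "(nat \<times> nat \<times> nat \<times> nat) set" where
  "g2_planes = {(1, 7, 5, 4), (2, 7, 4, 6), (4, 3, 1, 2), (6, 5, 1, 2), (5, 3, 6, 4), (3, 7, 1, 6)}"

text \<open>
  After expansion and sorting, both sides are combinations of the same basis forms, whose
  coefficients agree modulo \<open>c\<^sup>2 + s\<^sup>2 = 1\<close>. Eliminating \<open>c\<^sup>2\<close> leaves a polynomial identity.
\<close>

lemma g2_forms_rotate:
  assumes frame: "frame 7 e v" and cs: "c * c + s * s = 1"
    and pqrt: "(p, q, r, t) \<in> g2_planes"
  shows "g2_form (rotate_coframe p q c s (rotate_coframe r t c s e)) = g2_form e"
    and "g2_dual_form (rotate_coframe p q c s (rotate_coframe r t c s e)) = g2_dual_form e"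
proof -
  have c1: "c * c = 1 - s * s"
    using cs by linarith
  have c2: "c * (c * x) = x - s * (s * x)" for x
    using c1 by (metis left_diff_distrib mult.assoc mult_1)
  show "g2_form (rotate_coframe p q c s (rotate_coframe r t c s e)) = g2_form e"
    using pqrt unfolding g2_planes_def insert_iff empty_iff prod.inject g2_form_def rotate_coframe_def
    by (elim disjE conjE FalseE; hypsubst;
        simp add: wedge_linear wedge_sort[OF frame] del: One_nat_def;
        simp only: fun_eq_iff plus_fun_apply minus_apply uminus_apply scale_form_apply;
        simp add: algebra_simps c1 c2)
  show "g2_dual_form (rotate_coframe p q c s (rotate_coframe r t c s e)) = g2_dual_form e"
    using pqrt unfolding g2_planes_def insert_iff empty_iff prod.inject g2_dual_form_def rotate_coframe_def
    by (elim disjE conjE FalseE; hypsubst;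
        simp add: wedge_linear wedge_sort[OF frame] del: One_nat_def;
        simp only: fun_eq_iff plus_fun_apply minus_apply uminus_apply scale_form_apply;
        simp add: algebra_simps c1 c2)
qed


lemma rotation_angle: "\<exists>c s::real. c * c + s * s = 1 \<and> c * a + s * b = 0 \<and> c * b - s * a \<ge> 0"
proof (cases "a = 0 \<and> b = 0")
  case True
  then show ?thesis by (intro exI[of _ 1] exI[of _ 0]) simp
next
  case False
  define r where "r = sqrt (a * a + b * b)"
  have rr: "r * r = a * a + b * b" by (simp add: r_def)
  have r: "r > 0"
    using False by (auto simp: r_def sum_squares_gt_zero_iff)
  show ?thesis
  proof (intro exI conjI)
    have "(b / r) * (b / r) + (- a / r) * (- a / r) = (a * a + b * b) / (r * r)"
      by (simp add: add_divide_distrib)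
    then show "(b / r) * (b / r) + (- a / r) * (- a / r) = 1"
      unfolding rr[symmetric] using r by simp
    show "(b / r) * a + (- a / r) * b = 0" by simp
    have "(b / r) * b - (- a / r) * a = (a * a + b * b) / r"
      by (simp add: add_divide_distrib)
    then show "(b / r) * b - (- a / r) * a \<ge> 0"
      using r by simp
  qed
qed

definition g2_equivalent :: "(nat \<Rightarrow> ('a::real_vector) form) \<Rightarrow> (nat \<Rightarrow> 'a form) \<Rightarrow> bool" where
  "g2_equivalent e e' \<longleftrightarrow> (\<exists>v. frame 7 e' v) \<and> g2_form e' = g2_form e \<and>
     g2_dual_form e' = g2_dual_form e \<and> coframe_metric 7 e' = coframe_metric 7 e"

text \<open>
  The angle is chosen to turn the \<open>p\<close>-component of \<open>X\<close> into its \<open>q\<close>-component. The rotation in the second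
  plane does no harm if both components of \<open>X\<close> there are already zero, or if they have not been treated yet.
\<close>

lemma g2_rotate_component_away:
  assumes e: "g2_equivalent e0 e"
    and pqrt: "(p, q, r, t) \<in> g2_planes"
  shows "\<exists>e'. g2_equivalent e0 e' \<and> e' p [X] = 0 \<and> e' q [X] \<ge> 0 \<and>
     (e r [X] = 0 \<and> e t [X] = 0 \<longrightarrow> e' r [X] = 0 \<and> e' t [X] = 0) \<and>
     (\<forall>i. i \<notin> {p, q, r, t} \<longrightarrow> e' i [X] = e i [X])"
proof -
  obtain v where frame: "frame 7 e v" using e by (auto simp: g2_equivalent_def)
  obtain c s where cs: "c * c + s * s = 1" and
    cs': "c * e p [X] + s * e q [X] = 0" "c * e q [X] - s * e p [X] \<ge> 0"
    using rotation_angle by blast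
  have in7: "p \<in> {1..7}" "q \<in> {1..7}" "r \<in> {1..7}" "t \<in> {1..7}"
    and ne: "p \<noteq> q" "r \<noteq> t" "p \<notin> {r, t}" "q \<notin> {r, t}"
    using pqrt by (auto simp: g2_planes_def)
  define e' where "e' = rotate_coframe p q c s (rotate_coframe r t c s e)"
  have "\<exists>w. frame 7 e' w"
    unfolding e'_def using frame_rotate[OF frame_rotate[OF frame in7(3,4) ne(2) cs] in7(1,2) ne(1) cs]
    by blast
  moreover have "coframe_metric 7 e' = coframe_metric 7 e"
    unfolding e'_def using in7 ne cs by (simp add: coframe_metric_rotate fun_eq_iff)
  ultimately have "g2_equivalent e0 e'"
    using e g2_forms_rotate[OF frame cs pqrt] by (simp add: g2_equivalent_def e'_def)
  moreover have "e' p [X] = 0" "e' q [X] \<ge> 0"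
    "e r [X] = 0 \<and> e t [X] = 0 \<longrightarrow> e' r [X] = 0 \<and> e' t [X] = 0"
    "\<forall>i. i \<notin> {p, q, r, t} \<longrightarrow> e' i [X] = e i [X]"
    using cs' ne by (auto simp: e'_def rotate_coframe_def scale_form_apply)
  ultimately show ?thesis by blast
qed

text \<open>
  Six double rotations remove the components 1, 2, 4, 6, 5, 3 in this order. The second planes are
  (5,4), (4,6), (1,2), (1,2), (6,4), (1,6): the components in the first two are removed later, and
  those in the last four are already zero. The last rotation makes the seventh component
  nonnegative, hence 1.
\<close>

theorem g2_transitive_on_unit_vectors:
  assumes "frame 7 e v" "coframe_metric 7 e X X = 1"
  shows "\<exists>e'. g2_equivalent e e' \<and> (\<forall>i\<in>{1..6}. e' i [X] = 0) \<and> e' 7 [X] = 1"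
proof -
  have "g2_equivalent e e"
    using assms(1) by (auto simp: g2_equivalent_def)
  from g2_rotate_component_away[OF this, of 1 7 5 4 X]
  obtain a where a: "g2_equivalent e a" "a 1 [X] = 0"
    by (simp add: g2_planes_def) (elim exE conjE, erule that, simp_all)
  from g2_rotate_component_away[OF a(1), of 2 7 4 6 X] a(2)
  obtain b where b: "g2_equivalent e b" "b 1 [X] = 0" "b 2 [X] = 0"
    by (simp add: g2_planes_def) (elim exE conjE, erule that, simp_all)
  from g2_rotate_component_away[OF b(1), of 4 3 1 2 X] b(2,3)
  obtain c where c: "g2_equivalent e c" "c 1 [X] = 0" "c 2 [X] = 0" "c 4 [X] = 0"
    by (simp add: g2_planes_def) (elim exE conjE, erule that, simp_all)
  from g2_rotate_component_away[OF c(1), of 6 5 1 2 X] c(2-)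
  obtain d where d: "g2_equivalent e d" "d 1 [X] = 0" "d 2 [X] = 0" "d 4 [X] = 0" "d 6 [X] = 0"
    by (simp add: g2_planes_def) (elim exE conjE, erule that, simp_all)
  from g2_rotate_component_away[OF d(1), of 5 3 6 4 X] d(2-)
  obtain f where f: "g2_equivalent e f" "f 1 [X] = 0" "f 2 [X] = 0" "f 4 [X] = 0" "f 6 [X] = 0" "f 5 [X] = 0"
    by (simp add: g2_planes_def) (elim exE conjE, erule that, simp_all)
  from g2_rotate_component_away[OF f(1), of 3 7 1 6 X] f(2-)
  obtain h where h: "g2_equivalent e h" "h 1 [X] = 0" "h 2 [X] = 0" "h 4 [X] = 0" "h 6 [X] = 0"
      "h 5 [X] = 0" "h 3 [X] = 0" "h 7 [X] \<ge> 0"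
    by (simp add: g2_planes_def) (elim exE conjE, erule that, simp_all)
  have seven: "{1..7::nat} = {1, 2, 3, 4, 5, 6, 7}" and six: "{1..6::nat} = {1, 2, 3, 4, 5, 6}"
    by auto
  have "coframe_metric 7 h X X = 1"
    using h(1) assms(2) by (simp add: g2_equivalent_def)
  then have "h 7 [X] * h 7 [X] = 1"
    unfolding coframe_metric_def seven using h(2-7) by simp
  then have "h 7 [X] = 1"
    using h(8) by (simp add: square_eq_1_iff)
  then show ?thesis
    using h unfolding six by (intro exI[of _ h]) simp
qed


section \<open>\<open>SU(3)\<close>-structures and their torsion\<close>

lemma complex_form_wedge:
  "complex_form a b \<and>\<^sub>F complex_form c d =
    complex_form ((a \<and>\<^sub>F c) - (b \<and>\<^sub>F d)) ((a \<and>\<^sub>F d) + (b \<and>\<^sub>F c))"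
proof
  fix vs
  have sgn: "(-1) ^ n * Complex x y * Complex z w =
      Complex ((-1) ^ n * x * z - (-1) ^ n * y * w) ((-1) ^ n * x * w + (-1) ^ n * y * z)" for n x y z w
    by (cases "even n") (simp_all add: complex_eq_iff)
  show "(complex_form a b \<and>\<^sub>F complex_form c d) vs =
    complex_form ((a \<and>\<^sub>F c) - (b \<and>\<^sub>F d)) ((a \<and>\<^sub>F d) + (b \<and>\<^sub>F c)) vs"
    by (simp add: complex_form_def wedge_def sgn complex_eq_iff sum_subtractf sum.distrib)
qed

lemma complex_form_eq_iff: "complex_form a b = complex_form c d \<longleftrightarrow> a = c \<and> b = d"
  by (auto simp: complex_form_def fun_eq_iff)

lemma unit_form_apply: "unit_form [] = 1" "unit_form (x # xs) = 0"
  by (simp_all add: unit_form_def)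

definition kaehler_form :: "(nat \<Rightarrow> 'a form) \<Rightarrow> 'a form" where
  "kaehler_form e = (e 1 \<and>\<^sub>F e 2) + (e 3 \<and>\<^sub>F e 4) + (e 5 \<and>\<^sub>F e 6)"

definition re_volume :: "(nat \<Rightarrow> 'a form) \<Rightarrow> 'a form" where
  "re_volume e = (e 1 \<and>\<^sub>F e 3 \<and>\<^sub>F e 5) - (e 1 \<and>\<^sub>F e 4 \<and>\<^sub>F e 6)
     - (e 2 \<and>\<^sub>F e 3 \<and>\<^sub>F e 6) - (e 2 \<and>\<^sub>F e 4 \<and>\<^sub>F e 5)"

definition im_volume :: "(nat \<Rightarrow> 'a form) \<Rightarrow> 'a form" where
  "im_volume e = (e 1 \<and>\<^sub>F e 3 \<and>\<^sub>F e 6) + (e 1 \<and>\<^sub>F e 4 \<and>\<^sub>F e 5)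
     + (e 2 \<and>\<^sub>F e 3 \<and>\<^sub>F e 5) - (e 2 \<and>\<^sub>F e 4 \<and>\<^sub>F e 6)"

lemma su3_structure_iff:
  "su3_structure \<omega> \<psi>p \<psi>m \<longleftrightarrow>
    (\<exists>e v. frame 6 e v \<and> \<omega> = kaehler_form e \<and> \<psi>p = re_volume e \<and> \<psi>m = im_volume e)"
proof -
  have "complex_form (e 1) (e 2) \<and>\<^sub>F complex_form (e 3) (e 4) \<and>\<^sub>F complex_form (e 5) (e 6) =
      complex_form (re_volume e) (im_volume e)" for e :: "nat \<Rightarrow> 'a form"
    by (simp add: complex_form_wedge wedge_linear re_volume_def im_volume_def algebra_simps)
  then show ?thesis
    unfolding su3_structure_def kaehler_form_def complex_form_eq_iff
    by (metis coframe_has_dual_frame frame_imp_coframe complex_form_eq_iff)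
qed

context
  fixes e :: "nat \<Rightarrow> ('a::real_vector) form" and v
  assumes frame: "frame 6 e v"
begin

lemma is_form_kaehler: "is_form 2 (kaehler_form e)"
  and is_form_re_volume: "is_form 3 (re_volume e)"
  and is_form_im_volume: "is_form 3 (im_volume e)"
  unfolding kaehler_form_def re_volume_def im_volume_def
  by (intro is_form_intros frame_form[OF frame]; simp)+

text \<open>
  On the dual frame, \<open>J (v 1) = v 2\<close>, \<open>J (v 2) = - v 1\<close>, and likewise for the other two pairs: then
  \<open>e 1 + \<i> e 2\<close> is complex linear, and so is the complex volume form.
\<close>

lemma acs_exists:
  "\<exists>J. is_acs (re_volume e) (im_volume e) J \<and>
     (\<forall>x. e 1 [J x] = - e 2 [x] \<and> e 2 [J x] = e 1 [x] \<and> e 3 [J x] = - e 4 [x] \<and>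
          e 4 [J x] = e 3 [x] \<and> e 5 [J x] = - e 6 [x] \<and> e 6 [J x] = e 5 [x])"
proof -
  have form: "is_form 1 (e 1)" "is_form 1 (e 2)" "is_form 1 (e 3)" "is_form 1 (e 4)" "is_form 1 (e 5)" "is_form 1 (e 6)"
    by (rule frame_form[OF frame]; simp)+
  have six: "{1..6::nat} = {1, 2, 3, 4, 5, 6}" by auto
  have lin: "e i [a + b] = e i [a] + e i [b]" "e i [a - b] = e i [a] - e i [b]" "e i [c *\<^sub>R a] = c * e i [a]" "e i [- a] = - e i [a]"
    if "i \<in> {1..6}" for i a b c
  proof -
    note l = linear_form_1[OF frame_form[OF frame that]]
    show "e i [a + b] = e i [a] + e i [b]" "e i [a - b] = e i [a] - e i [b]" "e i [c *\<^sub>R a] = c * e i [a]" "e i [- a] = - e i [a]"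
      using linear_add[OF l] linear_diff[OF l] linear_cmul[OF l] linear_neg[OF l] by simp_all
  qed
  define J where "J x = (- e 2 [x]) *\<^sub>R v 1 + e 1 [x] *\<^sub>R v 2 + (- e 4 [x]) *\<^sub>R v 3
    + e 3 [x] *\<^sub>R v 4 + (- e 6 [x]) *\<^sub>R v 5 + e 5 [x] *\<^sub>R v 6" for x
  have eJ: "e 1 [J x] = - e 2 [x] \<and> e 2 [J x] = e 1 [x] \<and> e 3 [J x] = - e 4 [x] \<and>
          e 4 [J x] = e 3 [x] \<and> e 5 [J x] = - e 6 [x] \<and> e 6 [J x] = e 5 [x]" for x
    unfolding J_def by (simp add: lin frame_dual[OF frame] del: One_nat_def)
  have "linear J"
    unfolding J_def by (rule linearI) (simp_all add: lin algebra_simps del: One_nat_def)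
  moreover have "J (J x) = - x" for x
  proof -
    have "- x = - (\<Sum>i\<in>{1..6}. e i [x] *\<^sub>R v i)" using frame_expand[OF frame, of x] by metis
    then show ?thesis
      unfolding six J_def[of "J x"] by (simp add: eJ del: One_nat_def)
  qed
  moreover have "complex_form (re_volume e) (im_volume e) [J x, y, z] =
      \<i> * complex_form (re_volume e) (im_volume e) [x, y, z]" for x y z
    unfolding complex_form_def re_volume_def im_volume_def complex_eq_iff
    by (simp add: form wedge_1_Cons contract_1_wedge contract_1 eJ scale_form_apply unit_form_apply
        wedge_unit_right wedge_linear algebra_simps del: One_nat_def)
  ultimately show ?thesis
    using eJ unfolding is_acs_def by blast
qed

end


text \<open>
  Each bracket stands in the slot of its second argument.
\<close>

lemma cartan_d_4:
  "cartan_d br \<alpha> [a, b, c, d] =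
    - \<alpha> [br a b, c, d] - \<alpha> [b, br a c, d] - \<alpha> [b, c, br a d]
    + \<alpha> [a, br b c, d] + \<alpha> [a, c, br b d] - \<alpha> [a, b, br c d]"
  by (simp add: contract_def)

context
  fixes br :: "'a::real_vector \<Rightarrow> 'a \<Rightarrow> 'a" and e :: "nat \<Rightarrow> 'a form" and v
  assumes frame: "frame 6 e v"
begin

lemma kaehler_wedge_kaehler:
  "kaehler_form e \<and>\<^sub>F kaehler_form e = 2 *\<^sub>F ((e 1 \<and>\<^sub>F e 2 \<and>\<^sub>F e 3 \<and>\<^sub>F e 4)
     + (e 1 \<and>\<^sub>F e 2 \<and>\<^sub>F e 5 \<and>\<^sub>F e 6) + (e 3 \<and>\<^sub>F e 4 \<and>\<^sub>F e 5 \<and>\<^sub>F e 6))"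
  unfolding kaehler_form_def
  by (simp add: wedge_linear wedge_assoc wedge_sort[OF frame] del: One_nat_def)
    (simp add: fun_eq_iff scale_form_apply)

text \<open>
  The six equations say that \<open>d \<psi>\<^sub>+\<close> is of type (2,2): they are the real and imaginary parts of the
  vanishing of its wedge product with the (2,0)-forms \<open>(e 1 + \<i> e 2) \<and> (e 3 + \<i> e 4)\<close> etc. For \<open>d \<Omega>\<close>
  such products vanish identically, whatever the structure constants, which is what the displayed
  relations between \<open>A\<close> and \<open>B\<close> express; and the values \<open>B\<close> of \<open>d \<psi>\<^sub>-\<close> that occur in them are zero,
  because \<open>\<omega>\<^sup>2\<close> only has components on pairs of complex lines.
\<close>

lemma ce_d_volume_type:
  assumes im: "ce_d br (im_volume e) = k *\<^sub>F (kaehler_form e \<and>\<^sub>F kaehler_form e)"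
  defines "A \<equiv> \<lambda>js. ce_d br (re_volume e) (map v js)"
  shows "A [2,4,5,6] = A [1,3,5,6]" "A [2,3,5,6] = - A [1,4,5,6]" "A [2,3,4,6] = A [1,3,4,5]"
    "A [2,3,4,5] = - A [1,3,4,6]" "A [1,2,4,6] = A [1,2,3,5]" "A [1,2,4,5] = - A [1,2,3,6]"
proof -
  define B where "B = (\<lambda>js. ce_d br (im_volume e) (map v js))"
  have form: "is_form 1 (e 1)" "is_form 1 (e 2)" "is_form 1 (e 3)" "is_form 1 (e 4)" "is_form 1 (e 5)" "is_form 1 (e 6)"
    by (rule frame_form[OF frame]; simp)+
  have alt: "alternating (re_volume e)" "alternating (im_volume e)"
    using is_form_re_volume[OF frame] is_form_im_volume[OF frame] by (simp_all add: is_form_iff)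
  have B0: "B [2,4,5,6] = 0" "B [1,3,5,6] = 0" "B [2,3,5,6] = 0" "B [1,4,5,6] = 0"
    "B [2,3,4,6] = 0" "B [1,3,4,5] = 0" "B [2,3,4,5] = 0" "B [1,3,4,6] = 0"
    "B [1,2,4,6] = 0" "B [1,2,3,5] = 0" "B [1,2,4,5] = 0" "B [1,2,3,6] = 0"
    unfolding B_def im kaehler_wedge_kaehler
    by (simp_all add: scale_form_apply wedge_frame_eval[OF frame] frame_dual_map[OF frame] del: list.map One_nat_def)
  have A: "A [a,b,c,d] = cartan_d br (re_volume e) [v a, v b, v c, v d]" for a b c d
    by (simp add: A_def ce_d_eq_cartan_d alt)
  have B: "B [a,b,c,d] = cartan_d br (im_volume e) [v a, v b, v c, v d]" for a b c d
    by (simp add: B_def ce_d_eq_cartan_d alt)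
  note eval = re_volume_def im_volume_def form wedge_1_Cons contract_1_wedge contract_1
    scale_form_apply unit_form_apply wedge_unit_right wedge_linear frame_dual[OF frame]
  have "A [1,3,5,6] - A [2,4,5,6] = B [2,3,5,6] + B [1,4,5,6]"
    "A [2,3,5,6] + A [1,4,5,6] = B [2,4,5,6] - B [1,3,5,6]"
    "A [1,3,4,5] - A [2,3,4,6] = B [2,3,4,5] + B [1,3,4,6]"
    "A [2,3,4,5] + A [1,3,4,6] = B [2,3,4,6] - B [1,3,4,5]"
    "A [1,2,3,5] - A [1,2,4,6] = B [1,2,4,5] + B [1,2,3,6]"
    "A [1,2,4,5] + A [1,2,3,6] = B [1,2,4,6] - B [1,2,3,5]"
    unfolding A B cartan_d_4 by (simp_all add: eval algebra_simps del: One_nat_def)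
  then show "A [2,4,5,6] = A [1,3,5,6]" "A [2,3,5,6] = - A [1,4,5,6]" "A [2,3,4,6] = A [1,3,4,5]"
    "A [2,3,4,5] = - A [1,3,4,6]" "A [1,2,4,6] = A [1,2,3,5]" "A [1,2,4,5] = - A [1,2,3,6]"
    unfolding B0 by simp_all
qed

text \<open>
  The nine free values of \<open>d \<psi>\<^sub>+\<close> that \<open>ce_d_volume_type\<close> leaves are matched by the coefficients of \<open>c\<close> and
  of a (1,1)-form \<open>\<beta>\<close>.
\<close>

theorem torsion_of_nearly_half_flat:
  assumes lie: "lie_algebra br"
    and im: "ce_d br (im_volume e) = k *\<^sub>F (kaehler_form e \<and>\<^sub>F kaehler_form e)"
    and W4: "kaehler_form e \<and>\<^sub>F ce_d br (kaehler_form e) = 0"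
  shows "torsion_type_W1_W2minus_W3 br (kaehler_form e) (re_volume e) (im_volume e)"
proof -
  let ?\<omega> = "kaehler_form e" and ?\<psi>p = "re_volume e" and ?\<psi>m = "im_volume e"
  obtain J where J: "is_acs ?\<psi>p ?\<psi>m J" and eJ: "\<And>x. e 1 [J x] = - e 2 [x]" "\<And>x. e 2 [J x] = e 1 [x]"
    "\<And>x. e 3 [J x] = - e 4 [x]" "\<And>x. e 4 [J x] = e 3 [x]" "\<And>x. e 5 [J x] = - e 6 [x]"
    "\<And>x. e 6 [J x] = e 5 [x]"
    using acs_exists[OF frame] by blast
  have "primitive_11 ?\<omega> ?\<psi>p ?\<psi>m 0"
    using J by (auto simp: primitive_11_def is_form_zero wedge_zero_left simp del: zero_fun_apply) (auto)
  then have "four_form_components ?\<omega> ?\<psi>p ?\<psi>m (ce_d br ?\<psi>m) k 0 0"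
    by (simp add: four_form_components_def is_form_zero im wedge_zero_left)
  then have m: "W2_component_vanishes ?\<omega> ?\<psi>p ?\<psi>m (ce_d br ?\<psi>m)"
      "W5_component_vanishes ?\<omega> ?\<psi>p ?\<psi>m (ce_d br ?\<psi>m)"
    unfolding W2_component_vanishes_def W5_component_vanishes_def by blast+
  define A where "A = (\<lambda>js. ce_d br ?\<psi>p (map v js))"
  have A: "ce_d br ?\<psi>p (map v js) = A js" for js
    by (simp add: A_def)
  note rel = ce_d_volume_type[OF im, unfolded A]
  \<comment> \<open>\<open>\<beta> \<and> \<omega>\<close> with the diagonal part \<open>x e\<^sup>1\<^sup>2 + y e\<^sup>3\<^sup>4 + z e\<^sup>5\<^sup>6\<close> of \<open>\<beta>\<close> contributes \<open>x + y\<close>, \<open>x + z\<close>, \<open>y + z\<close>; primitivity is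
    \<open>x + y + z = 0\<close>, which forces \<open>6 c\<close> to be the sum of the three values of \<open>d \<psi>\<^sub>+\<close>\<close>
  define c where "c = (A [1,2,3,4] + A [1,2,5,6] + A [3,4,5,6]) / 6"
  define x where "x = 2 * c - A [3,4,5,6]"
  define y where "y = 2 * c - A [1,2,5,6]"
  define \<beta> where "\<beta> = x *\<^sub>F (e 1 \<and>\<^sub>F e 2) + y *\<^sub>F (e 3 \<and>\<^sub>F e 4) + (- x - y) *\<^sub>F (e 5 \<and>\<^sub>F e 6)
    + A [1,3,5,6] *\<^sub>F ((e 1 \<and>\<^sub>F e 3) + (e 2 \<and>\<^sub>F e 4))
    + A [1,4,5,6] *\<^sub>F ((e 1 \<and>\<^sub>F e 4) - (e 2 \<and>\<^sub>F e 3))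
    + A [1,3,4,5] *\<^sub>F ((e 1 \<and>\<^sub>F e 5) + (e 2 \<and>\<^sub>F e 6))
    + A [1,3,4,6] *\<^sub>F ((e 1 \<and>\<^sub>F e 6) - (e 2 \<and>\<^sub>F e 5))
    + A [1,2,3,5] *\<^sub>F ((e 3 \<and>\<^sub>F e 5) + (e 4 \<and>\<^sub>F e 6))
    + A [1,2,3,6] *\<^sub>F ((e 3 \<and>\<^sub>F e 6) - (e 4 \<and>\<^sub>F e 5))"
  have form: "is_form 1 (e 1)" "is_form 1 (e 2)" "is_form 1 (e 3)" "is_form 1 (e 4)" "is_form 1 (e 5)" "is_form 1 (e 6)"
    by (rule frame_form[OF frame]; simp)+
  have \<beta>_form: "is_form 2 \<beta>"
    unfolding \<beta>_def by (intro is_form_intros form)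
  have \<beta>_wedge: "\<beta> \<and>\<^sub>F ?\<omega> =
      (x + y) *\<^sub>F (e 1 \<and>\<^sub>F e 2 \<and>\<^sub>F e 3 \<and>\<^sub>F e 4) - y *\<^sub>F (e 1 \<and>\<^sub>F e 2 \<and>\<^sub>F e 5 \<and>\<^sub>F e 6)
      - x *\<^sub>F (e 3 \<and>\<^sub>F e 4 \<and>\<^sub>F e 5 \<and>\<^sub>F e 6)
      + A [1,3,5,6] *\<^sub>F ((e 1 \<and>\<^sub>F e 3 \<and>\<^sub>F e 5 \<and>\<^sub>F e 6) + (e 2 \<and>\<^sub>F e 4 \<and>\<^sub>F e 5 \<and>\<^sub>F e 6))
      + A [1,4,5,6] *\<^sub>F ((e 1 \<and>\<^sub>F e 4 \<and>\<^sub>F e 5 \<and>\<^sub>F e 6) - (e 2 \<and>\<^sub>F e 3 \<and>\<^sub>F e 5 \<and>\<^sub>F e 6))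
      + A [1,3,4,5] *\<^sub>F ((e 1 \<and>\<^sub>F e 3 \<and>\<^sub>F e 4 \<and>\<^sub>F e 5) + (e 2 \<and>\<^sub>F e 3 \<and>\<^sub>F e 4 \<and>\<^sub>F e 6))
      + A [1,3,4,6] *\<^sub>F ((e 1 \<and>\<^sub>F e 3 \<and>\<^sub>F e 4 \<and>\<^sub>F e 6) - (e 2 \<and>\<^sub>F e 3 \<and>\<^sub>F e 4 \<and>\<^sub>F e 5))
      + A [1,2,3,5] *\<^sub>F ((e 1 \<and>\<^sub>F e 2 \<and>\<^sub>F e 3 \<and>\<^sub>F e 5) + (e 1 \<and>\<^sub>F e 2 \<and>\<^sub>F e 4 \<and>\<^sub>F e 6))
      + A [1,2,3,6] *\<^sub>F ((e 1 \<and>\<^sub>F e 2 \<and>\<^sub>F e 3 \<and>\<^sub>F e 6) - (e 1 \<and>\<^sub>F e 2 \<and>\<^sub>F e 4 \<and>\<^sub>F e 5))"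
    unfolding \<beta>_def kaehler_form_def
    by (simp add: wedge_linear wedge_assoc wedge_sort[OF frame] del: One_nat_def)
      (simp add: fun_eq_iff scale_form_apply algebra_simps)
  have "\<beta> \<and>\<^sub>F ?\<omega> \<and>\<^sub>F ?\<omega> = (\<beta> \<and>\<^sub>F ?\<omega>) \<and>\<^sub>F ?\<omega>"
    by (simp add: wedge_assoc)
  also have "\<dots> = 0"
    unfolding \<beta>_wedge unfolding kaehler_form_def
    by (simp add: wedge_linear wedge_assoc wedge_sort[OF frame] del: One_nat_def)
      (simp add: fun_eq_iff scale_form_apply algebra_simps)
  finally have prim: "\<beta> \<and>\<^sub>F ?\<omega> \<and>\<^sub>F ?\<omega> = 0" .
  have "\<beta> [J u, J w] = \<beta> [u, w]" for u w
    unfolding \<beta>_def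
    by (simp add: form wedge_1_Cons contract_1 contract_scale contract_unit wedge_linear eJ
        scale_form_apply unit_form_apply algebra_simps del: One_nat_def)
  with J \<beta>_form prim have "primitive_11 ?\<omega> ?\<psi>p ?\<psi>m \<beta>"
    unfolding primitive_11_def by blast
  moreover have "ce_d br ?\<psi>p = c *\<^sub>F (?\<omega> \<and>\<^sub>F ?\<omega>) + (\<beta> \<and>\<^sub>F ?\<omega>)"
  proof (rule form_eq_on_frameI[OF _ _ frame])
    show "is_form 4 (ce_d br ?\<psi>p)"
      using is_form_ce_d[OF lie is_form_re_volume[OF frame]] by simp
    show "is_form 4 (c *\<^sub>F (?\<omega> \<and>\<^sub>F ?\<omega>) + (\<beta> \<and>\<^sub>F ?\<omega>))"
      unfolding kaehler_wedge_kaehler \<beta>_wedge by (intro is_form_intros form)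
    show "\<forall>js\<in>set (subseqs [1..<Suc 6]). length js = 4 \<longrightarrow>
        ce_d br ?\<psi>p (map v js) = (c *\<^sub>F (?\<omega> \<and>\<^sub>F ?\<omega>) + (\<beta> \<and>\<^sub>F ?\<omega>)) (map v js)"
      unfolding kaehler_wedge_kaehler \<beta>_wedge A
      by (simp add: Let_def upt_rec wedge_frame_eval[OF frame] frame_dual_map[OF frame] scale_form_apply
          rel x_def y_def del: list.map One_nat_def) (simp add: c_def field_simps)
  qed
  ultimately have "four_form_components ?\<omega> ?\<psi>p ?\<psi>m (ce_d br ?\<psi>p) c \<beta> 0"
    by (simp add: four_form_components_def is_form_zero wedge_zero_left)
  then have "W5_component_vanishes ?\<omega> ?\<psi>p ?\<psi>m (ce_d br ?\<psi>p)"
    unfolding W5_component_vanishes_def by blast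
  then show ?thesis
    using m W4 unfolding torsion_type_W1_W2minus_W3_def by blast
qed

end


section \<open>Passing to the quotient by a central vector\<close>

lemma pullback_wedge: "pullback q (\<alpha> \<and>\<^sub>F \<beta>) = pullback q \<alpha> \<and>\<^sub>F pullback q \<beta>"
  by (simp add: pullback_def wedge_def nths_map)

lemma pullback_add: "pullback q (\<alpha> + \<beta>) = pullback q \<alpha> + pullback q \<beta>"
  and pullback_diff: "pullback q (\<alpha> - \<beta>) = pullback q \<alpha> - pullback q \<beta>"
  and pullback_scale: "pullback q (c *\<^sub>F \<alpha>) = c *\<^sub>F pullback q \<alpha>"
  by (simp_all add: pullback_def scale_form_def fun_eq_iff)

lemma pullback_inject:
  assumes "surj q" "pullback q \<alpha> = pullback q \<beta>"
  shows "\<alpha> = \<beta>"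
proof
  fix vs
  have "vs = map q (map (inv q) vs)"
    using assms(1) by (simp add: surj_iff)
  then show "\<alpha> vs = \<beta> vs"
    using fun_cong[OF assms(2), of "map (inv q) vs"] by (simp only: pullback_def)
qed

lemma has_degree_scale: "has_degree k \<alpha> \<Longrightarrow> has_degree k (c *\<^sub>F \<alpha>)"
  by (simp add: has_degree_def scale_form_apply)

lemma has_degree_pullback: "has_degree k \<alpha> \<Longrightarrow> has_degree k (pullback q \<alpha>)"
  by (simp add: has_degree_def pullback_def)

lemma lie_derivative_central:
  assumes "in_center br X" "multilinear \<alpha>"
  shows "lie_derivative br X \<alpha> = 0"
proof
  show "lie_derivative br X \<alpha> vs = (0 :: 'a form) vs" for vs
    using assms(2)
  proof (induction vs arbitrary: \<alpha>)
    case (Cons w ws)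
    have "\<alpha> (br X w # ws) = 0"
      using assms(1) contract_scale_vector[OF Cons.prems, of 0 0]
      by (simp add: in_center_def form_Cons zero_scale)
    then show ?case
      using Cons.IH[OF multilinear_contract[OF Cons.prems]] by simp
  qed simp
qed

text \<open>
  A covector that annihilates \<open>X\<close> takes equal values on vectors with the same image under \<open>q\<close>, so it is
  the pullback of a covector on the quotient. Since \<open>X\<close> itself is the last frame vector, the images of
  the others form the dual frame.
\<close>

lemma frame_descends:
  assumes frame: "frame (Suc n) h v" and q: "linear q" "surj q" "{x. q x = 0} = span {X}"
    and X: "\<forall>i\<in>{1..n}. h i [X] = 0" "h (Suc n) [X] = 1"
  shows "\<exists>f. frame n f (q \<circ> v) \<and> (\<forall>i\<in>{1..n}. pullback q (f i) = h i)"
proof -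
  define f where "f i = pullback (inv q) (h i)" for i
  have form: "is_form 1 (h i)" if "i \<in> {1..n}" for i
    using that by (intro frame_form[OF frame]) auto
  have eq: "h i [a] = h i [b]" if "q a = q b" "i \<in> {1..n}" for i a b
  proof -
    note lin = linear_form_1[OF form[OF that(2)]]
    have "a - b \<in> {x. q x = 0}"
      using that(1) by (simp add: linear_diff[OF q(1)])
    then obtain c where "a - b = c *\<^sub>R X"
      unfolding q(3) by (auto simp: span_singleton)
    then have "h i [a - b] = 0"
      using X(1) that(2) linear_cmul[OF lin] by simp
    then show ?thesis using linear_diff[OF lin] by simp
  qed
  have q_inv: "q (inv q y) = y" for y
    using q(2) by (simp add: surj_f_inv_f)
  have fq: "f i [q x] = h i [x]" if "i \<in> {1..n}" for i x
    unfolding f_def pullback_def list.map using eq[OF q_inv that] .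
  have f_form: "is_form 1 (f i)" if "i \<in> {1..n}" for i
    unfolding is_form_1_iff
  proof
    show "has_degree 1 (f i)"
      using form[OF that] unfolding f_def is_form_iff by (intro has_degree_pullback) simp
    note lin = linear_form_1[OF form[OF that]]
    show "linear (\<lambda>y. f i [y])"
    proof (rule linearI)
      fix x y :: 'b and c :: real
      show "f i [x + y] = f i [x] + f i [y]"
        using fq[OF that, of "inv q x + inv q y"] linear_add[OF lin, of "inv q x" "inv q y"]
        by (simp add: linear_add[OF q(1)] q_inv f_def pullback_def)
      show "f i [c *\<^sub>R x] = c *\<^sub>R f i [x]"
        using fq[OF that, of "c *\<^sub>R inv q x"] linear_cmul[OF lin, of c "inv q x"]
        by (simp add: linear_cmul[OF q(1)] q_inv f_def pullback_def)
    qed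
  qed
  have "X = v (Suc n)"
  proof -
    have "X = (\<Sum>i\<in>{1..Suc n}. h i [X] *\<^sub>R v i)" by (rule frame_expand[OF frame])
    then show ?thesis using X by simp
  qed
  moreover have "q X = 0"
    using q(3) span_base[of X "{X}"] by auto
  ultimately have qv: "q (v (Suc n)) = 0" by simp
  have "frame n f (q \<circ> v)"
    unfolding frame_def
  proof (intro conjI ballI allI)
    fix i j assume ij: "i \<in> {1..n}" "j \<in> {1..n}"
    show "f i [(q \<circ> v) j] = (if i = j then 1 else 0)"
      using fq[OF ij(1)] frame_dual[OF frame, of i j] ij by simp
  next
    fix y
    obtain x where y: "y = q x" using q(2) by blast
    have "q x = q (\<Sum>i\<in>{1..Suc n}. h i [x] *\<^sub>R v i)"
      using frame_expand[OF frame, of x] by metis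
    also have "\<dots> = (\<Sum>i\<in>{1..Suc n}. h i [x] *\<^sub>R q (v i))"
      by (simp only: linear_sum[OF q(1)] linear_cmul[OF q(1)])
    also have "\<dots> = (\<Sum>i\<in>{1..n}. h i [x] *\<^sub>R q (v i))"
      by (simp add: qv)
    also have "\<dots> = (\<Sum>i\<in>{1..n}. f i [y] *\<^sub>R (q \<circ> v) i)"
      unfolding y by (intro sum.cong) (simp_all add: fq)
    finally show "y = (\<Sum>i\<in>{1..n}. f i [y] *\<^sub>R (q \<circ> v) i)" using y by simp
  qed (rule f_form)
  moreover have "pullback q (f i) = h i" if "i \<in> {1..n}" for i
  proof (rule form_1_eqI)
    show "is_form 1 (pullback q (f i))"
      unfolding is_form_1_iff
    proof
      show "has_degree 1 (pullback q (f i))"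
        using f_form[OF that] unfolding is_form_iff by (intro has_degree_pullback) simp
      show "linear (\<lambda>x. pullback q (f i) [x])"
        using linear_form_1[OF form[OF that]] fq[OF that] by (simp add: pullback_def)
    qed
  qed (use form fq that in \<open>simp_all add: pullback_def\<close>)
  ultimately show ?thesis by blast
qed

context
  fixes h :: "nat \<Rightarrow> ('a::real_vector) form" and v X
  assumes frame: "frame 7 h v" and X: "\<forall>i\<in>{1..6}. h i [X] = 0" "h 7 [X] = 1"
begin

text \<open>
  This is the splitting \<open>\<phi> = \<omega> \<and> \<theta> + \<psi>\<^sub>+\<close>, \<open>\<Phi> = \<omega>\<^sup>2/2 + \<psi>\<^sub>- \<and> \<theta>\<close> for \<open>\<theta> = h 7\<close>.
\<close>

lemma g2_contractions:
  "contract X (g2_form h) = kaehler_form h"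
  "contract X (g2_dual_form h) = - im_volume h"
  "g2_dual_form h - (im_volume h \<and>\<^sub>F h 7) = (1/2) *\<^sub>F (kaehler_form h \<and>\<^sub>F kaehler_form h)"
proof -
  have form: "is_form 1 (h 1)" "is_form 1 (h 2)" "is_form 1 (h 3)" "is_form 1 (h 4)" "is_form 1 (h 5)"
    "is_form 1 (h 6)" "is_form 1 (h 7)"
    by (rule frame_form[OF frame]; simp)+
  have x: "h 1 [X] = 0" "h 2 [X] = 0" "h 3 [X] = 0" "h 4 [X] = 0" "h 5 [X] = 0" "h 6 [X] = 0"
    using X by simp_all
  show "contract X (g2_form h) = kaehler_form h" "contract X (g2_dual_form h) = - im_volume h"
    unfolding g2_form_def g2_dual_form_def kaehler_form_def im_volume_def
    by (simp_all add: form x X(2) contract_add contract_diff contract_1_wedge contract_1 wedge_linear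
        zero_scale one_scale wedge_unit_right algebra_simps del: One_nat_def)
  show "g2_dual_form h - (im_volume h \<and>\<^sub>F h 7) = (1/2) *\<^sub>F (kaehler_form h \<and>\<^sub>F kaehler_form h)"
    unfolding g2_dual_form_def kaehler_form_def im_volume_def
    by (simp add: wedge_linear wedge_assoc wedge_sort[OF frame] del: One_nat_def)
      (simp add: fun_eq_iff scale_form_apply)
qed

end

theorem proposition1:
  fixes br :: "'a::real_vector \<Rightarrow> 'a \<Rightarrow> 'a"
    and br' :: "'b::real_vector \<Rightarrow> 'b \<Rightarrow> 'b"
    and q :: "'a \<Rightarrow> 'b"
    and e :: "nat \<Rightarrow> 'a form"
    and \<phi> \<Phi> \<theta> :: "'a form"
    and X :: 'a
  assumes "lie_algebra br"
    and "dim (UNIV :: 'a set) = 7"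
    and "g2_adapted e \<phi>"
    and "is_hodge_star 7 e 3 \<phi> \<Phi>"
    and "locally_conformally_cocalibrated br \<Phi> \<theta>"
    and "\<forall>Y. coframe_metric 7 e X Y = \<theta> [Y]"
    and "\<theta> [X] = 1"
    and "in_center br X"
    and "lie_quotient_by_line br X br' q"
  shows "\<exists>\<omega> \<psi>m. is_form 2 \<omega> \<and> is_form 3 \<psi>m \<and>
    pullback q \<omega> = contract X \<phi> \<and>
    pullback q \<psi>m = - contract X \<Phi> \<and>
    \<Phi> - (pullback q \<psi>m \<and>\<^sub>F \<theta>) = pullback q ((1/2) *\<^sub>F (\<omega> \<and>\<^sub>F \<omega>)) \<and>
    (\<exists>\<psi>p. su3_structure \<omega> \<psi>p \<psi>m) \<and>
    nearly_half_flat br' \<omega> \<psi>m \<and>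
    (\<forall>\<psi>p. su3_structure \<omega> \<psi>p \<psi>m \<longrightarrow> torsion_type_W1_W2minus_W3 br' \<omega> \<psi>p \<psi>m)"
proof -
  have \<phi>: "\<phi> = g2_form e" and "is_coframe 7 e"
    using assms(3) by (auto simp: g2_adapted_def g2_form_def)
  then obtain v0 where v0: "frame 7 e v0" using coframe_has_dual_frame by blast
  have \<Phi>: "\<Phi> = g2_dual_form e"
    using hodge_star_g2_form[OF v0] assms(4) \<phi> by simp
  have "coframe_metric 7 e X X = 1"
    using assms(6,7) by simp
  then obtain h where "g2_equivalent e h" and X: "\<forall>i\<in>{1..6}. h i [X] = 0" "h 7 [X] = 1"
    using g2_transitive_on_unit_vectors[OF v0] by blast
  then obtain v where frame: "frame 7 h v" and \<phi>h: "\<phi> = g2_form h" and \<Phi>h: "\<Phi> = g2_dual_form h"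
    and metric: "coframe_metric 7 h = coframe_metric 7 e"
    using \<phi> \<Phi> unfolding g2_equivalent_def by metis
  have \<theta>1: "is_form 1 \<theta>" and d\<theta>: "ce_d br \<theta> = 0" and d\<Phi>: "ce_d br \<Phi> = \<theta> \<and>\<^sub>F \<Phi>"
    using assms(5) by (auto simp: locally_conformally_cocalibrated_def)
  have \<theta>: "\<theta> = h 7"
  proof (rule form_1_eqI[OF \<theta>1 frame_form[OF frame]])
    fix Y
    have "{1..7::nat} = insert 7 {1..6}" by auto
    then have "coframe_metric 7 h X Y = h 7 [Y]"
      unfolding coframe_metric_def using X by simp
    then show "\<theta> [Y] = h 7 [Y]"
      using assms(6) metric by simp
  qed simp
  have lie': "lie_algebra br'" and q: "linear q" "surj q" "{x. q x = 0} = span {X}"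
    and hom: "\<And>x y. q (br x y) = br' (q x) (q y)"
    using assms(9) by (auto simp: lie_quotient_by_line_def)
  obtain f w where f: "frame 6 f w" and fh: "\<forall>i\<in>{1..6}. pullback q (f i) = h i"
    using frame_descends[of 6 h v q X] frame q X by auto
  define \<omega> where "\<omega> = kaehler_form f"
  define \<psi>m where "\<psi>m = im_volume f"
  have forms: "is_form 2 \<omega>" "is_form 3 \<psi>m"
    unfolding \<omega>_def \<psi>m_def by (rule is_form_kaehler[OF f] is_form_im_volume[OF f])+
  have fh': "pullback q (f 1) = h 1" "pullback q (f 2) = h 2" "pullback q (f 3) = h 3"
    "pullback q (f 4) = h 4" "pullback q (f 5) = h 5" "pullback q (f 6) = h 6"
    using fh by auto
  have pull: "pullback q \<omega> = kaehler_form h" "pullback q \<psi>m = im_volume h"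
    unfolding \<omega>_def \<psi>m_def kaehler_form_def im_volume_def
    by (simp_all add: pullback_add pullback_diff pullback_wedge fh' del: One_nat_def)
  define \<sigma> where "\<sigma> = (1/2) *\<^sub>F (\<omega> \<and>\<^sub>F \<omega>)"
  have contr: "contract X \<phi> = pullback q \<omega>" "contract X \<Phi> = - pullback q \<psi>m"
    and \<sigma>: "\<Phi> - (pullback q \<psi>m \<and>\<^sub>F \<theta>) = pullback q \<sigma>"
    using g2_contractions[OF frame X]
    by (simp_all add: \<phi>h \<Phi>h \<theta> pull \<sigma>_def pullback_scale pullback_wedge)
  have su3: "su3_structure \<omega> (re_volume f) \<psi>m"
    using f unfolding su3_structure_iff \<omega>_def \<psi>m_def by blast
  have \<Phi>_form: "is_form 4 \<Phi>"
    using assms(4) by (simp add: is_hodge_star_def)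
  have D\<Phi>: "cartan_d br \<Phi> = \<theta> \<and>\<^sub>F \<Phi>"
    using d\<Phi> \<Phi>_form ce_d_eq_cartan_d[of \<Phi> br] by (simp add: is_form_iff)
  have D\<theta>: "cartan_d br \<theta> = 0"
    using d\<theta> \<theta>1 ce_d_eq_cartan_d[of \<theta> br] unfolding is_form_iff by metis
  have deg: "has_degree 1 \<theta>" "has_degree 3 (pullback q \<psi>m)" "has_degree 4 (pullback q \<sigma>)"
    using \<theta>1 forms has_degree_wedge[of 2 \<omega> 2 \<omega>]
    by (auto simp: is_form_iff \<sigma>_def intro!: has_degree_pullback has_degree_scale)
  have comm3: "\<theta> \<and>\<^sub>F pullback q \<psi>m = - (pullback q \<psi>m \<and>\<^sub>F \<theta>)"
    using wedge_commute[OF deg(1,2)] by (simp add: minus_form)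
  have comm4: "\<theta> \<and>\<^sub>F pullback q \<sigma> = pullback q \<sigma> \<and>\<^sub>F \<theta>"
    using wedge_commute[OF deg(1,3)] by (simp add: one_scale)
  \<comment> \<open>Cartan's formula for the central vector \<open>X\<close>\<close>
  have D\<psi>: "cartan_d br (pullback q \<psi>m) = pullback q \<sigma>"
  proof -
    have "cartan_d br (contract X \<Phi>) = - contract X (\<theta> \<and>\<^sub>F \<Phi>)"
      using contract_cartan_d[of X br \<Phi>] lie_derivative_central[OF assms(8), of \<Phi>] \<Phi>_form
      by (simp add: D\<Phi> is_form_iff)
    also have "contract X (\<theta> \<and>\<^sub>F \<Phi>) = \<Phi> - (\<theta> \<and>\<^sub>F contract X \<Phi>)"
      using contract_1_wedge[OF \<theta>1] assms(7) by (simp add: one_scale)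
    also have "\<dots> = pullback q \<sigma>"
      using \<sigma> by (simp add: contr wedge_minus_right comm3)
    finally show ?thesis
      unfolding contr cartan_d_minus by (simp only: neg_equal_iff_equal)
  qed
  have D\<psi>': "cartan_d br' \<psi>m = \<sigma>"
    using D\<psi> unfolding cartan_d_pullback[of q br br', OF hom] by (rule pullback_inject[OF q(2)])
  then have d\<psi>: "ce_d br' \<psi>m = (1/2) *\<^sub>F (\<omega> \<and>\<^sub>F \<omega>)"
    using forms ce_d_eq_cartan_d[of \<psi>m br'] by (simp add: is_form_iff \<sigma>_def)
  \<comment> \<open>the parts of \<open>d \<Phi> = \<theta> \<and> \<Phi>\<close> that come from \<open>d \<psi>\<^sub>- \<and> \<theta>\<close> and from \<open>\<theta> \<and> \<sigma>\<close> cancel\<close>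
  have D\<sigma>: "cartan_d br (pullback q \<sigma>) = 0"
  proof -
    have split: "\<Phi> = pullback q \<sigma> + (pullback q \<psi>m \<and>\<^sub>F \<theta>)"
      using \<sigma> by (simp add: algebra_simps)
    have "\<theta> \<and>\<^sub>F \<Phi> = cartan_d br (pullback q \<sigma> + (pullback q \<psi>m \<and>\<^sub>F \<theta>))"
      unfolding D\<Phi>[symmetric] split[symmetric] ..
    also have "\<dots> = cartan_d br (pullback q \<sigma>) + (pullback q \<sigma> \<and>\<^sub>F \<theta>)"
      by (simp add: cartan_d_add cartan_d_wedge D\<psi> D\<theta> wedge_zero_right)
    finally have 1: "\<theta> \<and>\<^sub>F \<Phi> = cartan_d br (pullback q \<sigma>) + (pullback q \<sigma> \<and>\<^sub>F \<theta>)" .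
    have 2: "\<theta> \<and>\<^sub>F \<Phi> = pullback q \<sigma> \<and>\<^sub>F \<theta>"
    proof -
      have "\<theta> \<and>\<^sub>F pullback q \<psi>m \<and>\<^sub>F \<theta> = - (pullback q \<psi>m \<and>\<^sub>F \<theta> \<and>\<^sub>F \<theta>)"
        using comm3 wedge_assoc[of \<theta> "pullback q \<psi>m" \<theta>] wedge_assoc[of "pullback q \<psi>m" \<theta> \<theta>]
        by (simp add: wedge_minus_left)
      then have "\<theta> \<and>\<^sub>F pullback q \<psi>m \<and>\<^sub>F \<theta> = 0"
        by (simp add: wedge_1_self[OF \<theta>1] wedge_zero_right)
      then show ?thesis
        by (subst split) (simp add: wedge_add_right comm4)
    qed
    from 1[unfolded 2] show ?thesis by simp
  qed
  have D\<omega>: "ce_d br' \<omega> = cartan_d br' \<omega>"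
    using forms by (simp add: is_form_iff ce_d_eq_cartan_d)
  from D\<sigma> have "cartan_d br' \<sigma> = 0"
    unfolding cartan_d_pullback[of q br br', OF hom]
    by (intro pullback_inject[OF q(2)]) (simp add: pullback_def fun_eq_iff)
  then have "0 = (1/2) *\<^sub>F ((cartan_d br' \<omega> \<and>\<^sub>F \<omega>) + (\<omega> \<and>\<^sub>F cartan_d br' \<omega>))"
    using forms grade_degree[of 2 \<omega>]
    by (simp add: \<sigma>_def cartan_d_scale cartan_d_wedge is_form_iff one_scale)
  also have "cartan_d br' \<omega> \<and>\<^sub>F \<omega> = \<omega> \<and>\<^sub>F cartan_d br' \<omega>"
    using wedge_commute[OF has_degree_cartan_d[of 2 \<omega> br'], of 2 \<omega>] forms
    by (simp add: is_form_iff one_scale)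
  also have "(1/2) *\<^sub>F ((\<omega> \<and>\<^sub>F cartan_d br' \<omega>) + (\<omega> \<and>\<^sub>F cartan_d br' \<omega>)) = \<omega> \<and>\<^sub>F cartan_d br' \<omega>"
    by (simp add: fun_eq_iff scale_form_apply)
  finally have W4: "\<omega> \<and>\<^sub>F ce_d br' \<omega> = 0"
    unfolding D\<omega> by (rule sym)
  have "torsion_type_W1_W2minus_W3 br' \<omega> \<psi>p \<psi>m" if su3': "su3_structure \<omega> \<psi>p \<psi>m" for \<psi>p
  proof -
    obtain g u where g: "frame 6 g u" and eqs: "\<omega> = kaehler_form g" "\<psi>p = re_volume g" "\<psi>m = im_volume g"
      using su3' unfolding su3_structure_iff by blast
    show ?thesis
      using torsion_of_nearly_half_flat[OF g lie', folded eqs] d\<psi> W4 by blast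
  qed
  moreover have "nearly_half_flat br' \<omega> \<psi>m"
    using d\<psi> unfolding nearly_half_flat_def by (intro exI[of _ "1/2"]) simp
  ultimately show ?thesis
    using forms contr \<sigma> su3 unfolding \<sigma>_def by (intro exI[of _ \<omega>] exI[of _ \<psi>m]) (auto simp del: minus_apply)
qed

end
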